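(* The algebra $\mathcal{A}^{gen}$ is free as a module over $\mathbb{C}[\mathcal{P}]$ with basis $\{A^{\alpha}B^{\beta}C^{\gamma}\}_{\alpha,\beta,\gamma\in\mathbb{Z}_{\geq 0}}$. Its Hilbert--Poincaré series as a filtered $\mathbb{C}[\mathcal{P}]$-algebra is $$\frac{1}{(1-t^3)(1-t^4)(1-t^6)}.$$
   Context: Let $\mathcal{P}=\{a_0,a'_0,a_1,a_2,a_3,a_4,a_5,a_6,a_8,a_9\}$ be a set of indeterminates and $\mathbb{C}[\mathcal{P}]$ the commutative polynomial algebra in them. The algebra $\mathcal{A}^{gen}$ is the associative unital algebra over $\mathbb{C}[\mathcal{P}]$ (so the elements of $\mathcal{P}$ are central) generated by $A,B,C$ with defining relations $$[A,B]=C,$$ $$[A,C]=a_0B^2+a_1\{A,B\}+a_2A^2+a_4B+a_5A+a_8,$$ $$[B,C]=a'_0A^3-a_1B^2-a_2\{A,B\}+a_3A^2-a_5B+a_6A+a_9,$$ where $[x,y]=xy-yx$ and $\{x,y\}=xy+yx$. The algebra is filtered by setting $\deg(A)=3$, $\deg(B)=4$, $\deg(C)=6$, with elements of $\mathbb{C}[\mathcal{P}]$ of degree $0$: $\mathcal{A}^{gen}_n$ is the $\mathbb{C}[\mathcal{P}]$-span of words in the generators of total degree at most $n$ (and $\mathcal{A}^{gen}_{-1}=0$). The Hilbert--Poincaré series is the generating series in $t$ recording the ranks over $\mathbb{C}[\mathcal{P}]$ of the graded components $\mathcal{A}^{gen}_n/\mathcal{A}^{gen}_{n-1}$. *)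

theory Defs
  imports
    "HOL-Library.Poly_Mapping"
    "HOL-Algebra.AbelCoset"
    "HOL-Algebra.Module"
    "HOL-Computational_Algebra.Formal_Power_Series"
begin

datatype param = a0 | a0' | a1 | a2 | a3 | a4 | a5 | a6 | a8 | a9

text \<open>The polynomial algebra over the complex numbers in the indeterminates \<^typ>\<open>param\<close>:
  finitely supported coefficient functions on monomials, a monomial being a finitely supported
  exponent function.\<close>

type_synonym cpoly = "(param \<Rightarrow>\<^sub>0 nat) \<Rightarrow>\<^sub>0 complex"

definition indet :: "param \<Rightarrow> cpoly" where
  "indet i = Poly_Mapping.single (Poly_Mapping.single i 1) 1"

datatype gen = GenA | GenB | GenC

text \<open>The free monoid on the generators.  It is written additively because multiplication of
  \<^typ>\<open>'a \<Rightarrow>\<^sub>0 'b\<close> is convolution along addition on \<^typ>\<open>'a\<close>; the addition below is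
  concatenation and not commutative.\<close>

datatype gword = Word (letters: "gen list")

instantiation gword :: monoid_add
begin

definition zero_gword :: gword where
  "0 = Word []"

definition plus_gword :: "gword \<Rightarrow> gword \<Rightarrow> gword" where
  "u + v = Word (letters u @ letters v)"

instance
  by standard (auto simp: zero_gword_def plus_gword_def)

end

type_synonym free_alg = "gword \<Rightarrow>\<^sub>0 cpoly"

definition const :: "cpoly \<Rightarrow> free_alg" where
  "const p = Poly_Mapping.single 0 p"

definition letter :: "gen \<Rightarrow> free_alg" where
  "letter g = Poly_Mapping.single (Word [g]) 1"

definition commutator :: "'a::ring \<Rightarrow> 'a \<Rightarrow> 'a" where
  "commutator x y = x * y - y * x"

definition anticommutator :: "'a::ring \<Rightarrow> 'a \<Rightarrow> 'a" where
  "anticommutator x y = x * y + y * x"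

definition relators :: "free_alg set" where
  "relators =
    (let A = letter GenA; B = letter GenB; C = letter GenC; k = (\<lambda>i. const (indet i)) in
     {commutator A B - C,
      commutator A C -
        (k a0 * B ^ 2 + k a1 * anticommutator A B + k a2 * A ^ 2 + k a4 * B + k a5 * A + k a8),
      commutator B C -
        (k a0' * A ^ 3 - k a1 * B ^ 2 - k a2 * anticommutator A B + k a3 * A ^ 2
          - k a5 * B + k a6 * A + k a9)})"

inductive_set rel_ideal :: "free_alg set" where
  relator: "r \<in> relators \<Longrightarrow> r \<in> rel_ideal"
| zero: "0 \<in> rel_ideal"
| add: "x \<in> rel_ideal \<Longrightarrow> y \<in> rel_ideal \<Longrightarrow> x + y \<in> rel_ideal"
| mult_left: "x \<in> rel_ideal \<Longrightarrow> u * x \<in> rel_ideal"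
| mult_right: "x \<in> rel_ideal \<Longrightarrow> x * u \<in> rel_ideal"

lemma rel_ideal_minus: "x \<in> rel_ideal \<Longrightarrow> - x \<in> rel_ideal"
  using rel_ideal.mult_left[of x "- 1"] by simp

definition rel_cong :: "free_alg \<Rightarrow> free_alg \<Rightarrow> bool" where
  "rel_cong x y \<longleftrightarrow> x - y \<in> rel_ideal"

lemma equivp_rel_cong: "equivp rel_cong"
proof (rule equivpI)
  show "reflp rel_cong"
    by (auto simp: reflp_def rel_cong_def rel_ideal.zero)
  show "symp rel_cong"
    using rel_ideal_minus by (fastforce simp: symp_def rel_cong_def)
  show "transp rel_cong"
    using rel_ideal.add by (fastforce simp: transp_def rel_cong_def)
qed

quotient_type agen = free_alg / rel_cong
  by (rule equivp_rel_cong)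

text \<open>Nontriviality of the quotient is not established here, so it is only given the
  structure of an associative ring with unit (a \<^class>\<open>ring_1\<close> moreover satisfies
  \<^prop>\<open>0 \<noteq> 1\<close>).\<close>

instantiation agen :: "{ring, monoid_mult}"
begin

lift_definition zero_agen :: agen is 0 .

lift_definition one_agen :: agen is 1 .

lift_definition plus_agen :: "agen \<Rightarrow> agen \<Rightarrow> agen" is "(+)"
  unfolding rel_cong_def add_diff_add by (rule rel_ideal.add)

lift_definition uminus_agen :: "agen \<Rightarrow> agen" is uminus
  unfolding rel_cong_def minus_diff_minus by (rule rel_ideal_minus)

lift_definition minus_agen :: "agen \<Rightarrow> agen \<Rightarrow> agen" is "(-)"
proof -
  fix x y u v :: free_alg
  assume "rel_cong x y" "rel_cong u v"
  then have "(x - y) + - (u - v) \<in> rel_ideal"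
    unfolding rel_cong_def by (blast intro: rel_ideal.add rel_ideal_minus)
  then show "rel_cong (x - u) (y - v)"
    by (simp add: rel_cong_def algebra_simps)
qed

lift_definition times_agen :: "agen \<Rightarrow> agen \<Rightarrow> agen" is "(*)"
proof -
  fix x y u v :: free_alg
  assume "rel_cong x y" "rel_cong u v"
  then have "(x - y) * u + y * (u - v) \<in> rel_ideal"
    unfolding rel_cong_def
    by (blast intro: rel_ideal.add rel_ideal.mult_left rel_ideal.mult_right)
  then show "rel_cong (x * u) (y * v)"
    by (simp add: rel_cong_def algebra_simps)
qed

instance
proof
  fix a b c :: agen
  have eq: "rel_cong x y" if "x = y" for x y
    using that by (simp add: rel_cong_def rel_ideal.zero)
  show "a + b + c = a + (b + c)" by transfer (rule eq, rule add.assoc)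
  show "a + b = b + a" by transfer (rule eq, rule add.commute)
  show "0 + a = a" by transfer (rule eq, simp)
  show "- a + a = 0" by transfer (rule eq, simp)
  show "a - b = a + - b" by transfer (rule eq, simp)
  show "a * b * c = a * (b * c)" by transfer (rule eq, rule mult.assoc)
  show "(a + b) * c = a * c + b * c" by transfer (rule eq, rule distrib_right)
  show "a * (b + c) = a * b + a * c" by transfer (rule eq, rule distrib_left)
  show "1 * a = a" by transfer (rule eq, simp)
  show "a * 1 = a" by transfer (rule eq, simp)
qed

end

lift_definition gen_agen :: "gen \<Rightarrow> agen" is letter .

abbreviation "A_gen \<equiv> gen_agen GenA"
abbreviation "B_gen \<equiv> gen_agen GenB"
abbreviation "C_gen \<equiv> gen_agen GenC"

definition pbw_monomial :: "nat \<times> nat \<times> nat \<Rightarrow> agen" where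
  "pbw_monomial = (\<lambda>(\<alpha>, \<beta>, \<gamma>). A_gen ^ \<alpha> * B_gen ^ \<beta> * C_gen ^ \<gamma>)"

lift_definition scale :: "cpoly \<Rightarrow> agen \<Rightarrow> agen" is "\<lambda>p x. const p * x"
  unfolding rel_cong_def right_diff_distrib[symmetric] by (rule rel_ideal.mult_left)

lemma const_add: "const (p + q) = const p + const q"
  by (simp add: const_def single_add)

lemma const_mult: "const (p * q) = const p * const q"
  by (simp add: const_def mult_single)

lemma const_one: "const 1 = 1"
  by (simp add: const_def)

global_interpretation agen: Modules.module scale
proof
  fix p q :: cpoly and x y :: agen
  have eq: "rel_cong u v" if "u = v" for u v
    using that by (simp add: rel_cong_def rel_ideal.zero)
  show "scale p (x + y) = scale p x + scale p y"
    by transfer (rule eq, rule distrib_left)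
  show "scale (p + q) x = scale p x + scale q x"
    by transfer (rule eq, simp only: const_add distrib_right)
  show "scale p (scale q x) = scale (p * q) x"
    by transfer (rule eq, simp only: const_mult mult.assoc)
  show "scale 1 x = x"
    by transfer (rule eq, simp only: const_one mult_1_left)
qed

fun gen_degree :: "gen \<Rightarrow> nat" where
  "gen_degree GenA = 3"
| "gen_degree GenB = 4"
| "gen_degree GenC = 6"

text \<open>Indexing by integers gives the convention that the level \<open>- 1\<close> is zero.\<close>

definition agen_filt :: "int \<Rightarrow> agen set" where
  "agen_filt n =
    agen.span {prod_list (map gen_agen w) | w. int (sum_list (map gen_degree w)) \<le> n}"

lemma agen_filt_neg: "n < 0 \<Longrightarrow> agen_filt n = {0}"
proof -
  assume "n < 0"
  then have "{prod_list (map gen_agen w) | w. int (sum_list (map gen_degree w)) \<le> n} = {}"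
    by auto
  then show ?thesis
    by (simp only: agen_filt_def agen.span_empty)
qed

lemma agen_filt_mono: "m \<le> n \<Longrightarrow> agen_filt m \<subseteq> agen_filt n"
  unfolding agen_filt_def by (rule agen.span_mono) auto

text \<open>The quotient of a module by a submodule, with the library's additive cosets; the ring
  multiplication fields of the record play no role for modules and are left unspecified.\<close>

definition quot_module ::
  "('a, 'b, 'm) module_scheme \<Rightarrow> 'b set \<Rightarrow> ('a, 'b set) module" where
  "quot_module M N =
    \<lparr>carrier = a_rcosets\<^bsub>M\<^esub> N, monoid.mult = undefined, one = undefined,
     zero = N, add = set_add M,
     smult = (\<lambda>p X. \<Union>x\<in>X. N +>\<^bsub>M\<^esub> (p \<odot>\<^bsub>M\<^esub> x))\<rparr>"

lemma quot_module_sel [simp]: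
  "carrier (quot_module M N) = a_rcosets\<^bsub>M\<^esub> N"
  "zero (quot_module M N) = N"
  "add (quot_module M N) = set_add M"
  by (simp_all add: quot_module_def)

lemma abelian_subgroup_of_submodule:
  assumes "Module.module R M" "submodule N R M"
  shows "abelian_subgroup N M"
proof -
  interpret Module.module R M by fact
  interpret S: submodule N R M by fact
  show ?thesis
    by (rule abelian_subgroupI3)
       (auto intro: additive_subgroupI S.subgroup_axioms abelian_group_axioms)
qed

lemma quot_module_smult_coset:
  assumes "Module.module R M" "submodule N R M" "p \<in> carrier R" "x \<in> carrier M"
  shows "p \<odot>\<^bsub>quot_module M N\<^esub> (N +>\<^bsub>M\<^esub> x) = N +>\<^bsub>M\<^esub> (p \<odot>\<^bsub>M\<^esub> x)"
proof -
  interpret Module.module R M by fact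
  interpret S: submodule N R M by fact
  interpret A: abelian_subgroup N M
    using assms(1,2) by (rule abelian_subgroup_of_submodule)
  have "N +>\<^bsub>M\<^esub> (p \<odot>\<^bsub>M\<^esub> y) = N +>\<^bsub>M\<^esub> (p \<odot>\<^bsub>M\<^esub> x)" if y: "y \<in> N +>\<^bsub>M\<^esub> x" for y
  proof -
    obtain h where h: "h \<in> N" "y = h \<oplus>\<^bsub>M\<^esub> x"
      using y unfolding a_r_coset_def' by blast
    have hM: "h \<in> carrier M" using h(1) A.a_subset by (rule rev_subsetD)
    have "p \<odot>\<^bsub>M\<^esub> y = (p \<odot>\<^bsub>M\<^esub> h) \<oplus>\<^bsub>M\<^esub> (p \<odot>\<^bsub>M\<^esub> x)"
      unfolding h(2) using assms(3) hM assms(4) by (rule smult_r_distr)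
    moreover have "p \<odot>\<^bsub>M\<^esub> h \<in> N" using assms(3) h(1) by (rule S.smult_closed)
    ultimately have "p \<odot>\<^bsub>M\<^esub> y \<in> N +>\<^bsub>M\<^esub> (p \<odot>\<^bsub>M\<^esub> x)"
      unfolding a_r_coset_def' by blast
    then show ?thesis
      by (rule a_repr_independence[OF _ smult_closed[OF assms(3,4)] A.a_subgroup, symmetric])
  qed
  moreover have "x \<in> N +>\<^bsub>M\<^esub> x"
    using assms(4) by (rule A.a_rcos_self)
  ultimately have "(\<Union>y\<in>N +>\<^bsub>M\<^esub> x. N +>\<^bsub>M\<^esub> (p \<odot>\<^bsub>M\<^esub> y)) = N +>\<^bsub>M\<^esub> (p \<odot>\<^bsub>M\<^esub> x)"
    by blast
  then show ?thesis by (simp only: quot_module_def module.simps)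
qed

lemma module_quot_module:
  assumes M: "Module.module R M" and N: "submodule N R M"
  shows "Module.module R (quot_module M N)"
proof -
  interpret Module.module R M by fact
  interpret S: submodule N R M by fact
  interpret A: abelian_subgroup N M
    using assms by (rule abelian_subgroup_of_submodule)
  let ?Q = "quot_module M N"
  note sm = quot_module_smult_coset[OF M N]
  have coset: "\<exists>x\<in>carrier M. X = N +>\<^bsub>M\<^esub> x" if "X \<in> a_rcosets\<^bsub>M\<^esub> N" for X
    using that by (auto simp: A_RCOSETS_def')
  have rc: "N +>\<^bsub>M\<^esub> x \<in> a_rcosets\<^bsub>M\<^esub> N" if "x \<in> carrier M" for x
    using that A.a_subset a_rcosetsI by blast
  show ?thesis
  proof (rule moduleI)
    show "cring R" by (rule R.is_cring)
    show "abelian_group ?Q"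
    proof (rule abelian_groupI; unfold quot_module_sel)
      show "N \<in> a_rcosets\<^bsub>M\<^esub> N" by (rule A.a_subgroup_in_rcosets)
      show "X <+>\<^bsub>M\<^esub> Y \<in> a_rcosets\<^bsub>M\<^esub> N"
        if "X \<in> a_rcosets\<^bsub>M\<^esub> N" "Y \<in> a_rcosets\<^bsub>M\<^esub> N" for X Y
        using that by (rule A.a_setmult_closed)
      show "X <+>\<^bsub>M\<^esub> Y <+>\<^bsub>M\<^esub> Z = X <+>\<^bsub>M\<^esub> (Y <+>\<^bsub>M\<^esub> Z)"
        if "X \<in> a_rcosets\<^bsub>M\<^esub> N" "Y \<in> a_rcosets\<^bsub>M\<^esub> N" "Z \<in> a_rcosets\<^bsub>M\<^esub> N" for X Y Z
        using that by (rule A.a_rcosets_assoc)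
      show "X <+>\<^bsub>M\<^esub> Y = Y <+>\<^bsub>M\<^esub> X"
        if "X \<in> a_rcosets\<^bsub>M\<^esub> N" "Y \<in> a_rcosets\<^bsub>M\<^esub> N" for X Y
        using coset[OF that(1)] coset[OF that(2)] by (auto simp: A.a_rcos_sum M.a_comm)
      show "N <+>\<^bsub>M\<^esub> X = X" if "X \<in> a_rcosets\<^bsub>M\<^esub> N" for X
        using that by (rule A.rcosets_add_eq)
      show "\<exists>Y\<in>a_rcosets\<^bsub>M\<^esub> N. Y <+>\<^bsub>M\<^esub> X = N" if "X \<in> a_rcosets\<^bsub>M\<^esub> N" for X
        using that A.a_rcosets_inv_mult_group_eq A.a_setinv_closed by blast
    qed
  qed (auto dest!: coset simp: sm rc A.a_rcos_sum smult_l_distr smult_r_distr smult_assoc1)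
qed

text \<open>A basis of \<open>M\<close>: every element is a linear combination, with unique coefficients, of
  finitely many elements of \<open>B\<close>.\<close>

definition module_basis ::
  "('a, 'n) ring_scheme \<Rightarrow> ('a, 'b, 'm) module_scheme \<Rightarrow> 'b set \<Rightarrow> bool" where
  "module_basis R M B \<longleftrightarrow> B \<subseteq> carrier M \<and>
    (\<forall>x\<in>carrier M. \<exists>!c. (\<forall>b. c b \<in> carrier R) \<and>
       finite {b. c b \<noteq> \<zero>\<^bsub>R\<^esub>} \<and> {b. c b \<noteq> \<zero>\<^bsub>R\<^esub>} \<subseteq> B \<and>
       x = finsum M (\<lambda>b. c b \<odot>\<^bsub>M\<^esub> b) {b. c b \<noteq> \<zero>\<^bsub>R\<^esub>})"

definition free_of_rank ::
  "('a, 'n) ring_scheme \<Rightarrow> ('a, 'b, 'm) module_scheme \<Rightarrow> nat \<Rightarrow> bool" where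
  "free_of_rank R M r \<longleftrightarrow> (\<exists>B. module_basis R M B \<and> finite B \<and> card B = r)"

text \<open>Only meaningful for modules with a finite basis; over a nontrivial commutative ring all
  bases then have the same cardinality.\<close>

definition module_rank ::
  "('a, 'n) ring_scheme \<Rightarrow> ('a, 'b, 'm) module_scheme \<Rightarrow> nat" where
  "module_rank R M = (THE r. free_of_rank R M r)"

definition cpoly_ring :: "cpoly ring" where
  "cpoly_ring = \<lparr>carrier = UNIV, monoid.mult = (*), one = 1, zero = 0, add = (+)\<rparr>"

definition agen_filt_module :: "int \<Rightarrow> (cpoly, agen) module" where
  "agen_filt_module n =
    \<lparr>carrier = agen_filt n, monoid.mult = (*), one = 1, zero = 0, add = (+), smult = scale\<rparr>"

definition agen_gr :: "nat \<Rightarrow> (cpoly, agen set) module" where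
  "agen_gr n = quot_module (agen_filt_module (int n)) (agen_filt (int n - 1))"

definition agen_hilbert_series :: "rat fps" where
  "agen_hilbert_series = Abs_fps (\<lambda>n. of_nat (module_rank cpoly_ring (agen_gr n)))"

lemma cring_cpoly_ring: "cring cpoly_ring"
proof (rule cringI)
  show "abelian_group cpoly_ring"
  proof (rule abelian_groupI)
    show "\<exists>y\<in>carrier cpoly_ring. y \<oplus>\<^bsub>cpoly_ring\<^esub> x = \<zero>\<^bsub>cpoly_ring\<^esub>" for x
      by (rule bexI[of _ "- x"]) (simp_all add: cpoly_ring_def)
  qed (simp_all add: cpoly_ring_def algebra_simps)
  show "Group.comm_monoid cpoly_ring"
    by (rule comm_monoidI) (simp_all add: cpoly_ring_def algebra_simps)
qed (simp add: cpoly_ring_def algebra_simps)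

lemma module_agen_filt_module: "Module.module cpoly_ring (agen_filt_module n)"
proof (rule moduleI)
  show "cring cpoly_ring" by (rule cring_cpoly_ring)
  show "abelian_group (agen_filt_module n)"
  proof (rule abelian_groupI)
    show "\<exists>y\<in>carrier (agen_filt_module n). y \<oplus>\<^bsub>agen_filt_module n\<^esub> x = \<zero>\<^bsub>agen_filt_module n\<^esub>"
      if "x \<in> carrier (agen_filt_module n)" for x
      using that
      by (intro bexI[of _ "- x"]) (auto simp: agen_filt_module_def agen_filt_def agen.span_neg)
  qed (auto simp: agen_filt_module_def agen_filt_def agen.span_add agen.span_zero algebra_simps)
qed (auto simp: agen_filt_module_def agen_filt_def cpoly_ring_def agen.span_scale
       agen.scale_left_distrib agen.scale_right_distrib)

lemma a_inv_agen_filt_module: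
  assumes "x \<in> agen_filt n"
  shows "\<ominus>\<^bsub>agen_filt_module n\<^esub> x = - x"
proof -
  interpret Module.module cpoly_ring "agen_filt_module n" by (rule module_agen_filt_module)
  show ?thesis
  proof (rule M.minus_equality)
    show "- x \<oplus>\<^bsub>agen_filt_module n\<^esub> x = \<zero>\<^bsub>agen_filt_module n\<^esub>"
      by (simp add: agen_filt_module_def)
  qed (use assms in \<open>auto simp: agen_filt_module_def agen_filt_def agen.span_neg\<close>)
qed

lemma submodule_agen_filt:
  assumes "m \<le> n"
  shows "submodule (agen_filt m) cpoly_ring (agen_filt_module n)"
proof -
  interpret Module.module cpoly_ring "agen_filt_module n" by (rule module_agen_filt_module)
  note sub = agen_filt_mono[OF assms]
  show ?thesis
  proof (rule submoduleI)
    show "\<ominus>\<^bsub>agen_filt_module n\<^esub> x \<in> agen_filt m" if "x \<in> agen_filt m" for x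
      using that sub a_inv_agen_filt_module[of x n] agen.span_neg
      by (auto simp: agen_filt_def)
  qed (use sub in \<open>auto simp: agen_filt_module_def agen_filt_def agen.span_zero
         agen.span_add agen.span_scale\<close>)
qed

lemma module_agen_gr: "Module.module cpoly_ring (agen_gr n)"
  unfolding agen_gr_def
  by (intro module_quot_module module_agen_filt_module submodule_agen_filt) simp

end

theory Submission
  imports Defs "HOL-Library.Product_Plus"
begin

text \<open>The relations let \<open>B\<close> and \<open>C\<close> be pushed to the right past \<open>A\<close>, and \<open>C\<close> past \<open>B\<close>, without
  raising the degree; so left multiplication by the generators, written on the candidate basis,
  is given by operators on the free module with that basis.  By their recursion these operators
  satisfy the first two relations.  Hence, by the Jacobi identity, the difference of the two sides
  of the third relation commutes with \<open>A\<close>, and it vanishes on the basis elements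
  \<open>B\<^sup>\<beta> C\<^sup>\<gamma>\<close>, so it is zero.  The free module thus becomes a module over the algebra, and acting
  on the vector \<open>1\<close> recovers the coordinates of an element; in particular the basis elements of
  degree exactly \<open>n\<close> are a basis of the \<open>n\<close>-th graded component.\<close>

section \<open>Linear extension\<close>

text \<open>The scalar action is an argument because values are taken both in the free module and in
  the algebra.\<close>

definition lin_ext ::
  "('r::zero \<Rightarrow> 'm \<Rightarrow> 'm) \<Rightarrow> ('k \<Rightarrow> 'm) \<Rightarrow> ('k \<Rightarrow>\<^sub>0 'r) \<Rightarrow> 'm::comm_monoid_add" where
  "lin_ext s f v = (\<Sum>k\<in>Poly_Mapping.keys v. s (Poly_Mapping.lookup v k) (f k))"

context Modules.module
begin

lemma lin_ext_superset:
  fixes v :: "'k \<Rightarrow>\<^sub>0 'a"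
  assumes "finite K" "Poly_Mapping.keys v \<subseteq> K"
  shows "lin_ext scale f v = (\<Sum>k\<in>K. Poly_Mapping.lookup v k *s f k)"
  unfolding lin_ext_def
  by (rule sum.mono_neutral_left) (use assms in \<open>auto simp: in_keys_iff\<close>)

lemma lin_ext_single: "lin_ext scale f (Poly_Mapping.single k p) = p *s f k"
  by (subst lin_ext_superset[of "{k}"]) auto

lemma lin_ext_add: "lin_ext scale f (u + v) = lin_ext scale f u + lin_ext scale f v"
proof -
  let ?K = "Poly_Mapping.keys u \<union> Poly_Mapping.keys v"
  have "Poly_Mapping.keys (u + v) \<subseteq> ?K" by (rule Poly_Mapping.keys_add)
  then show ?thesis
    by (simp add: lin_ext_superset[of ?K] lookup_add scale_left_distrib sum.distrib)
qed

lemma lin_ext_0: "lin_ext scale f 0 = 0"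
  by (simp add: lin_ext_def)

lemma lin_ext_diff: "lin_ext scale f (u - v) = lin_ext scale f u - lin_ext scale f v"
  using lin_ext_add[of f "u - v" v] by (simp add: algebra_simps)

end

lemma lookup_single_0_mult:
  fixes v :: "'k::monoid_add \<Rightarrow>\<^sub>0 'r::semiring_0"
  shows "Poly_Mapping.lookup (Poly_Mapping.single 0 p * v) k = p * Poly_Mapping.lookup v k"
  by (simp flip: mult_map_scale_conv_mult add: Poly_Mapping.map.rep_eq when_def)

lemma (in Modules.module) lin_ext_single_0_mult:
  fixes v :: "'k::monoid_add \<Rightarrow>\<^sub>0 'a"
  shows "lin_ext scale f (Poly_Mapping.single 0 p * v) = p *s lin_ext scale f v"
proof -
  have "Poly_Mapping.keys (Poly_Mapping.single 0 p * v) \<subseteq> Poly_Mapping.keys v"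
    by (auto simp: in_keys_iff lookup_single_0_mult)
  then show ?thesis
    by (simp add: lin_ext_superset[of "Poly_Mapping.keys v"] lookup_single_0_mult scale_sum_right)
qed

text \<open>Inserting a fresh key amounts to adding a single term, and zero is a single term with
  coefficient 0.\<close>

lemma poly_mapping_single_induct [case_names add single]:
  fixes v :: "'k \<Rightarrow>\<^sub>0 'r::comm_monoid_add"
  assumes "\<And>u v. P u \<Longrightarrow> P v \<Longrightarrow> P (u + v)" "\<And>k p. P (Poly_Mapping.single k p)"
  shows "P v"
proof (induction v rule: Poly_Mapping.update_induct)
  case const
  show ?case using assms(2)[of _ 0] by simp
next
  case (update v k p)
  have "Poly_Mapping.update k p v = v + Poly_Mapping.single k p"
    using update(1) by (intro poly_mapping_eqI)
      (auto simp: lookup_update lookup_add lookup_single in_keys_iff when_def)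
  then show ?case using assms update by simp
qed

section \<open>Operators on the free module\<close>

text \<open>Triples add componentwise, so this type is also a commutative polynomial ring in three
  variables. Its product serves for scalars and for A, which acts as the first variable; B and C act
  by other operators.\<close>

type_synonym pbw_module = "(nat \<times> nat \<times> nat) \<Rightarrow>\<^sub>0 cpoly"

definition coef :: "cpoly \<Rightarrow> pbw_module" where
  "coef p = Poly_Mapping.single 0 p"

definition vmon :: "nat \<times> nat \<times> nat \<Rightarrow> pbw_module" where
  "vmon k = Poly_Mapping.single k 1"

lemma coef_add: "coef (p + q) = coef p + coef q"
  by (simp add: coef_def single_add)

lemma coef_mult: "coef (p * q) = coef p * coef q"
  by (simp add: coef_def mult_single)

lemma coef_1: "coef 1 = 1"
  by (simp add: coef_def)

lemma coef_mult_vmon: "coef p * vmon k = Poly_Mapping.single k p"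
  by (simp add: coef_def vmon_def mult_single)

abbreviation pbw_scale :: "cpoly \<Rightarrow> pbw_module \<Rightarrow> pbw_module" where
  "pbw_scale p v \<equiv> coef p * v"

global_interpretation pbw: Modules.module pbw_scale
  by standard (auto simp: algebra_simps coef_add coef_mult coef_1)

definition x_var :: pbw_module where
  "x_var = vmon (1, 0, 0)"

abbreviation A_op :: "pbw_module \<Rightarrow> pbw_module" where
  "A_op v \<equiv> x_var * v"

lemma x_var_mult_vmon: "x_var * vmon (\<alpha>, \<beta>, \<gamma>) = vmon (Suc \<alpha>, \<beta>, \<gamma>)"
  by (simp add: x_var_def vmon_def mult_single)

lemma vmon_induct [case_names add scale vmon]:
  assumes "\<And>u v. P u \<Longrightarrow> P v \<Longrightarrow> P (u + v)" "\<And>p v. P v \<Longrightarrow> P (coef p * v)" "\<And>k. P (vmon k)"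
  shows "P v"
  by (induction v rule: poly_mapping_single_induct) (metis assms coef_mult_vmon)+

text \<open>Scalar action and operators are arguments here and in \<open>rhs_BC\<close>, so that one
  formula can be read both in the algebra and on the free module.\<close>

definition rhs_AC ::
  "(cpoly \<Rightarrow> 'm \<Rightarrow> 'm) \<Rightarrow> ('m \<Rightarrow> 'm) \<Rightarrow> ('m \<Rightarrow> 'm) \<Rightarrow> 'm \<Rightarrow> 'm::ab_group_add" where
  "rhs_AC s A B v = s (indet a0) (B (B v)) + s (indet a1) (A (B v) + B (A v))
     + s (indet a2) (A (A v)) + s (indet a4) (B v) + s (indet a5) (A v) + s (indet a8) v"

definition rhs_BC ::
  "(cpoly \<Rightarrow> 'm \<Rightarrow> 'm) \<Rightarrow> ('m \<Rightarrow> 'm) \<Rightarrow> ('m \<Rightarrow> 'm) \<Rightarrow> 'm \<Rightarrow> 'm::ab_group_add" where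
  "rhs_BC s A B v = s (indet a0') (A (A (A v))) - s (indet a1) (B (B v))
     - s (indet a2) (A (B v) + B (A v)) + s (indet a3) (A (A v))
     - s (indet a5) (B v) + s (indet a6) (A v) + s (indet a9) v"

type_synonym operator = "pbw_module \<Rightarrow> pbw_module"

text \<open>The rewriting rule BA = AB - C at the leftmost letter of a monomial; the operator
  arguments stand for the recursive calls. Without a leading A the product is already
  ordered.\<close>

fun next_B :: "operator \<Rightarrow> operator \<Rightarrow> nat \<times> nat \<times> nat \<Rightarrow> pbw_module" where
  "next_B B C (0, \<beta>, \<gamma>) = vmon (0, Suc \<beta>, \<gamma>)"
| "next_B B C (Suc \<alpha>, \<beta>, \<gamma>) = x_var * B (vmon (\<alpha>, \<beta>, \<gamma>)) - C (vmon (\<alpha>, \<beta>, \<gamma>))"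

text \<open>The rules CA = AC - [A,C] and CB = BC - [B,C], with the commutators replaced by the
  right-hand sides of the relations.\<close>

fun next_C :: "operator \<Rightarrow> operator \<Rightarrow> nat \<times> nat \<times> nat \<Rightarrow> pbw_module" where
  "next_C B C (0, 0, \<gamma>) = vmon (0, 0, Suc \<gamma>)"
| "next_C B C (0, Suc \<beta>, \<gamma>) = B (C (vmon (0, \<beta>, \<gamma>))) - rhs_BC pbw_scale A_op B (vmon (0, \<beta>, \<gamma>))"
| "next_C B C (Suc \<alpha>, \<beta>, \<gamma>) = x_var * C (vmon (\<alpha>, \<beta>, \<gamma>)) - rhs_AC pbw_scale A_op B (vmon (\<alpha>, \<beta>, \<gamma>))"

text \<open>The recursion is well-founded on degrees, but it is nested; the first argument is fuel.\<close>

fun approx_B approx_C :: "nat \<Rightarrow> operator" where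
  "approx_B 0 = (\<lambda>v. 0)"
| "approx_C 0 = (\<lambda>v. 0)"
| "approx_B (Suc n) = lin_ext pbw_scale (next_B (approx_B n) (approx_C n))"
| "approx_C (Suc n) = lin_ext pbw_scale (next_C (approx_B n) (approx_C n))"

fun vdeg :: "nat \<times> nat \<times> nat \<Rightarrow> nat" where
  "vdeg (\<alpha>, \<beta>, \<gamma>) = 3 * \<alpha> + 4 * \<beta> + 6 * \<gamma>"

definition pbw_filt :: "nat \<Rightarrow> pbw_module set" where
  "pbw_filt d = pbw.span (vmon ` {k. vdeg k \<le> d})"

section \<open>Evaluation of coordinates in the algebra\<close>

definition pbw_eval :: "pbw_module \<Rightarrow> agen" where
  "pbw_eval = lin_ext scale pbw_monomial"

lemma pbw_eval_simps:
  "pbw_eval (u + v) = pbw_eval u + pbw_eval v"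
  "pbw_eval (u - v) = pbw_eval u - pbw_eval v"
  "pbw_eval (coef p * v) = scale p (pbw_eval v)"
  "pbw_eval (vmon k) = pbw_monomial k"
  by (simp_all add: pbw_eval_def coef_def vmon_def agen.lin_ext_add agen.lin_ext_diff
      agen.lin_ext_single_0_mult agen.lin_ext_single)

text \<open>Constants sit at the empty word, which is neutral for concatenation on both sides, and
  coefficients commute; hence the parameters are central.\<close>

lemma const_commute: "const p * x = x * const p"
  by (induction x rule: poly_mapping_single_induct)
    (simp_all add: algebra_simps const_def mult_single)

lemma scale_mult_left: "scale p x * y = scale p (x * y)"
  by transfer (simp add: rel_cong_def rel_ideal.zero mult.assoc)

lemma scale_mult_right: "x * scale p y = scale p (x * y)"
  by transfer (metis const_commute diff_self mult.assoc rel_cong_def rel_ideal.zero)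

text \<open>A letter A put in front of an ordered monomial keeps it ordered, so no rewriting
  occurs.\<close>

lemma pbw_eval_x_var: "pbw_eval (x_var * v) = A_gen * pbw_eval v"
proof (induction v rule: vmon_induct)
  case (vmon k)
  show ?case
    by (cases k) (simp add: x_var_mult_vmon pbw_eval_simps pbw_monomial_def mult.assoc)
qed (simp_all add: distrib_left pbw_eval_simps scale_mult_right mult.left_commute[of x_var])

text \<open>These are the defining relations times \<open>y\<close> on the right, oriented like the
  rules in \<open>next_B\<close> and \<open>next_C\<close>.\<close>

lemma agen_relations:
  "B_gen * (A_gen * y) = A_gen * (B_gen * y) - C_gen * y"
  "C_gen * (A_gen * y) = A_gen * (C_gen * y) - rhs_AC scale ((*) A_gen) ((*) B_gen) y"
  "C_gen * (B_gen * y) = B_gen * (C_gen * y) - rhs_BC scale ((*) A_gen) ((*) B_gen) y"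
proof -
  have 1: "A_gen * B_gen - B_gen * A_gen = C_gen"
    by transfer (auto simp: rel_cong_def relators_def Let_def commutator_def
        intro!: rel_ideal.relator)
  have 2: "A_gen * C_gen - C_gen * A_gen = rhs_AC scale ((*) A_gen) ((*) B_gen) 1"
    unfolding rhs_AC_def
    by transfer (auto simp: rel_cong_def relators_def Let_def commutator_def anticommutator_def
        power2_eq_square intro!: rel_ideal.relator)
  have 3: "B_gen * C_gen - C_gen * B_gen = rhs_BC scale ((*) A_gen) ((*) B_gen) 1"
    unfolding rhs_BC_def
    by transfer (auto simp: rel_cong_def relators_def Let_def commutator_def anticommutator_def
        power2_eq_square power3_eq_cube mult.assoc intro!: rel_ideal.relator)
  show "B_gen * (A_gen * y) = A_gen * (B_gen * y) - C_gen * y"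
    using arg_cong[OF 1, of "\<lambda>z. z * y"] by (simp add: algebra_simps)
  show "C_gen * (A_gen * y) = A_gen * (C_gen * y) - rhs_AC scale ((*) A_gen) ((*) B_gen) y"
    using arg_cong[OF 2, of "\<lambda>z. z * y"]
    by (simp add: algebra_simps rhs_AC_def scale_mult_left)
  show "C_gen * (B_gen * y) = B_gen * (C_gen * y) - rhs_BC scale ((*) A_gen) ((*) B_gen) y"
    using arg_cong[OF 3, of "\<lambda>z. z * y"]
    by (simp add: algebra_simps rhs_BC_def scale_mult_left)
qed

section \<open>The degree filtration of the free module\<close>

lemma pbw_filt_mono: "u \<in> pbw_filt d \<Longrightarrow> d \<le> e \<Longrightarrow> u \<in> pbw_filt e"
  unfolding pbw_filt_def using pbw.span_mono[of "vmon ` {k. vdeg k \<le> d}" "vmon ` {k. vdeg k \<le> e}"]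
  by fastforce

lemma vmon_in_pbw_filt: "vdeg k \<le> d \<Longrightarrow> vmon k \<in> pbw_filt d"
  unfolding pbw_filt_def by (rule pbw.span_base) auto

lemma pbw_filt_induct [consumes 1, case_names zero add scale vmon]:
  assumes "v \<in> pbw_filt d" "P 0"
    and "\<And>u v. P u \<Longrightarrow> P v \<Longrightarrow> P (u + v)" "\<And>p v. P v \<Longrightarrow> P (coef p * v)"
    and "\<And>k. vdeg k \<le> d \<Longrightarrow> P (vmon k)"
  shows "P v"
  using assms(1) unfolding pbw_filt_def
proof (induction rule: pbw.span_induct)
  case base
  show ?case using assms by (auto intro: pbw.subspaceI)
qed (use assms in auto)

lemma x_var_mult_in_pbw_filt:
  assumes "v \<in> pbw_filt d" shows "x_var * v \<in> pbw_filt (d + 3)"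
  using assms
proof (induction rule: pbw_filt_induct)
  case (vmon k)
  then show ?case by (cases k) (auto simp: x_var_mult_vmon intro: vmon_in_pbw_filt)
qed (auto simp: distrib_left mult.left_commute[of x_var] pbw_filt_def
       intro: pbw.span_zero pbw.span_add pbw.span_scale)

text \<open>Here \<open>u\<close> and \<open>u'\<close> are values computed with successive amounts of fuel, and \<open>y\<close> is the
  intended value in the algebra.\<close>

definition tracks :: "nat \<Rightarrow> pbw_module \<Rightarrow> pbw_module \<Rightarrow> agen \<Rightarrow> bool" where
  "tracks d u u' y \<longleftrightarrow> u \<in> pbw_filt d \<and> u' = u \<and> pbw_eval u = y"

lemma tracks_vmon: "vdeg k \<le> d \<Longrightarrow> tracks d (vmon k) (vmon k) (pbw_monomial k)"
  by (simp add: tracks_def vmon_in_pbw_filt pbw_eval_simps)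

lemma tracks_add: "tracks d u u' y \<Longrightarrow> tracks d v v' z \<Longrightarrow> tracks d (u + v) (u' + v') (y + z)"
  by (simp add: tracks_def pbw_filt_def pbw.span_add pbw_eval_simps)

lemma tracks_diff: "tracks d u u' y \<Longrightarrow> tracks d v v' z \<Longrightarrow> tracks d (u - v) (u' - v') (y - z)"
  by (simp add: tracks_def pbw_filt_def pbw.span_diff pbw_eval_simps)

lemma tracks_scale: "tracks d u u' y \<Longrightarrow> tracks d (coef p * u) (coef p * u') (scale p y)"
  by (simp add: tracks_def pbw_filt_def pbw.span_scale pbw_eval_simps)

lemma tracks_x_var:
  assumes "tracks e u u' y" "e + 3 \<le> d" shows "tracks d (x_var * u) (x_var * u') (A_gen * y)"
  using assms x_var_mult_in_pbw_filt[of u e] pbw_filt_mono[of "x_var * u" "e + 3" d]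
  by (auto simp: tracks_def pbw_eval_x_var)

lemma tracks_mono: "tracks d u u' y \<Longrightarrow> d \<le> e \<Longrightarrow> tracks e u u' y"
  by (auto simp: tracks_def intro: pbw_filt_mono)

lemma pbw_lin_ext_scale: "lin_ext pbw_scale f (coef p * v) = coef p * lin_ext pbw_scale f v"
  using pbw.lin_ext_single_0_mult[of f p v] by (simp only: coef_def)

lemma pbw_lin_ext_vmon: "lin_ext pbw_scale f (vmon k) = f k"
  by (simp add: vmon_def pbw.lin_ext_single coef_1)

section \<open>Values computed with enough fuel\<close>

lemma approx_linear:
  "approx_B n (u + v) = approx_B n u + approx_B n v"
  "approx_C n (u + v) = approx_C n u + approx_C n v"
  "approx_B n (coef p * v) = coef p * approx_B n v"
  "approx_C n (coef p * v) = coef p * approx_C n v"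
  "approx_B n 0 = 0"
  "approx_C n 0 = 0"
  by (cases n;
      simp only: approx_B.simps approx_C.simps pbw.lin_ext_add pbw.lin_ext_0 pbw_lin_ext_scale
        add_0_right mult_zero_right)+

declare approx_B.simps(2) [simp del] approx_C.simps(2) [simp del]

lemma approx_vmon:
  "approx_B (Suc n) (vmon k) = next_B (approx_B n) (approx_C n) k"
  "approx_C (Suc n) (vmon k) = next_C (approx_B n) (approx_C n) k"
  by (simp_all only: approx_B.simps approx_C.simps pbw_lin_ext_vmon)

text \<open>Every component of \<open>tracks\<close> is stable under linear combinations, so basis
  monomials suffice.\<close>

lemma tracks_linear:
  assumes "\<And>u v. F (u + v) = F u + F v" "\<And>p u. F (coef p * u) = coef p * F u" "F 0 = 0"
    and "\<And>u v. F' (u + v) = F' u + F' v" "\<And>p u. F' (coef p * u) = coef p * F' u" "F' 0 = 0"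
    and "\<And>k. vdeg k \<le> d \<Longrightarrow> tracks e (F (vmon k)) (F' (vmon k)) (g * pbw_monomial k)"
    and "v \<in> pbw_filt d"
  shows "tracks e (F v) (F' v) (g * pbw_eval v)"
  using assms(8)
proof (induction rule: pbw_filt_induct)
  case zero
  show ?case using pbw_eval_simps(3)[of 0 0] assms(3,6)
    by (simp add: tracks_def pbw_filt_def pbw.span_zero)
qed (simp_all add: assms tracks_add tracks_scale pbw_eval_simps distrib_left scale_mult_right)

text \<open>Acting with \<open>B\<close> or \<open>C\<close> so as to reach total degree \<open>t\<close> needs more than \<open>2 * t\<close>
  or \<open>2 * t + 1\<close> units of fuel: \<open>C\<close> calls \<open>B\<close> in the same total degree, all other calls
  lower it.\<close>

lemma approx_tracks:
  "(\<forall>d v. 2 * (d + 4) < n \<longrightarrow> v \<in> pbw_filt d \<longrightarrow>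
      tracks (d + 4) (approx_B n v) (approx_B (Suc n) v) (B_gen * pbw_eval v)) \<and>
   (\<forall>d v. 2 * (d + 6) + 1 < n \<longrightarrow> v \<in> pbw_filt d \<longrightarrow>
      tracks (d + 6) (approx_C n v) (approx_C (Suc n) v) (C_gen * pbw_eval v))"
proof (induction n)
  case 0
  then show ?case by simp
next
  case (Suc n)
  let ?B = "approx_B n" and ?C = "approx_C n" and ?B' = "approx_B (Suc n)" and ?C' = "approx_C (Suc n)"
  \<comment> \<open>\<open>tracks\<close> contains the equality of its two values, so the induction
    hypothesis also applies to tracked arguments, and calls can be nested.\<close>
  have B: "tracks (e + 4) (?B u) (?B' u') (B_gen * y)"
    if "tracks e u u' y" "2 * (e + 4) < n" for e u u' y
    using that Suc.IH by (auto simp: tracks_def)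
  have C: "tracks (e + 6) (?C u) (?C' u') (C_gen * y)"
    if "tracks e u u' y" "2 * (e + 6) + 1 < n" for e u u' y
    using that Suc.IH by (auto simp: tracks_def)
  have A: "tracks (e + 3) (A_op u) (A_op u') (A_gen * y)" if "tracks e u u' y" for e u u' y
    using that by (rule tracks_x_var) simp
  have B_vmon: "tracks (d + 4) (?B' (vmon k)) (approx_B (Suc (Suc n)) (vmon k)) (B_gen * pbw_monomial k)"
    if k: "vdeg k \<le> d" and n: "2 * (d + 4) < Suc n" for d k
  proof -
    obtain \<alpha> \<beta> \<gamma> where [simp]: "k = (\<alpha>, \<beta>, \<gamma>)" by (cases k)
    show ?thesis
    proof (cases \<alpha>)
      case 0
      have "tracks (d + 4) (vmon (0, Suc \<beta>, \<gamma>)) (vmon (0, Suc \<beta>, \<gamma>)) (pbw_monomial (0, Suc \<beta>, \<gamma>))"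
        using k 0 by (intro tracks_vmon) simp
      then show ?thesis using 0 by (simp add: approx_vmon pbw_monomial_def mult.assoc)
    next
      case (Suc a)
      define e where "e = vdeg (a, \<beta>, \<gamma>)"
      define v where "v = vmon (a, \<beta>, \<gamma>)"
      define y where "y = pbw_monomial (a, \<beta>, \<gamma>)"
      have e: "e + 3 \<le> d" using k Suc by (simp add: e_def)
      have m: "tracks e v v y"
        by (simp add: e_def v_def y_def tracks_vmon)
      have Bm: "tracks (e + 4) (?B v) (?B' v) (B_gen * y)"
        using m by (rule B) (use e n in simp)
      \<comment> \<open>This call of C reaches degree at most \<open>d + 3\<close>, one less than
        \<open>d + 4\<close>, which is just enough for the odd fuel bound of C.\<close>
      have Cm: "tracks (e + 6) (?C v) (?C' v) (C_gen * y)"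
        using m by (rule C) (use e n in simp)
      have eq: "pbw_monomial (Suc a, \<beta>, \<gamma>) = A_gen * y"
        by (simp add: y_def pbw_monomial_def mult.assoc)
      \<comment> \<open>The recursion and the relation in the algebra have the same shape, so the
        tracked values match term by term.\<close>
      show ?thesis
        unfolding \<open>k = _\<close> Suc approx_vmon next_B.simps eq agen_relations v_def[symmetric]
        by (rule tracks_diff; rule tracks_mono, rule A[OF Bm] Cm) (use e in simp_all)
    qed
  qed
  have C_vmon: "tracks (d + 6) (?C' (vmon k)) (approx_C (Suc (Suc n)) (vmon k)) (C_gen * pbw_monomial k)"
    if k: "vdeg k \<le> d" and n: "2 * (d + 6) + 1 < Suc n" for d k
  proof (cases k)
    case [simp]: (fields \<alpha> \<beta> \<gamma>)
    show ?thesis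
    proof (cases \<alpha>)
      case \<alpha>: (Suc a)
      define e where "e = vdeg (a, \<beta>, \<gamma>)"
      define v where "v = vmon (a, \<beta>, \<gamma>)"
      define y where "y = pbw_monomial (a, \<beta>, \<gamma>)"
      have e: "e + 3 \<le> d" using k \<alpha> by (simp add: e_def)
      have m: "tracks e v v y"
        by (simp add: e_def v_def y_def tracks_vmon)
      have Am: "tracks (e + 3) (A_op v) (A_op v) (A_gen * y)"
        using m by (rule A)
      have Bm: "tracks (e + 4) (?B v) (?B' v) (B_gen * y)"
        using m by (rule B) (use e n in simp)
      have Cm: "tracks (e + 6) (?C v) (?C' v) (C_gen * y)"
        using m by (rule C) (use e n in simp)
      have BBm: "tracks (e + 4 + 4) (?B (?B v)) (?B' (?B' v)) (B_gen * (B_gen * y))"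
        using Bm by (rule B) (use e n in simp)
      have BAm: "tracks (e + 3 + 4) (?B (A_op v)) (?B' (A_op v)) (B_gen * (A_gen * y))"
        using Am by (rule B) (use e n in simp)
      have eq: "pbw_monomial (Suc a, \<beta>, \<gamma>) = A_gen * y"
        by (simp add: y_def pbw_monomial_def mult.assoc)
      show ?thesis
        unfolding fields \<alpha> approx_vmon next_C.simps eq agen_relations(2) rhs_AC_def v_def[symmetric]
        by (intro tracks_add tracks_diff tracks_scale; rule tracks_mono,
            rule BBm A[OF Bm] BAm A[OF Am] A[OF Cm] Bm Am m) (use e in simp_all)
    next
      case \<alpha>: 0
      show ?thesis
      proof (cases \<beta>)
        case \<beta>: (Suc b)
        define e where "e = vdeg (0, b, \<gamma>)"
        define v where "v = vmon (0, b, \<gamma>)"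
        define y where "y = pbw_monomial (0, b, \<gamma>)"
        have e: "e + 4 \<le> d" using k \<alpha> \<beta> by (simp add: e_def)
        have m: "tracks e v v y"
          by (simp add: e_def v_def y_def tracks_vmon)
        have Am: "tracks (e + 3) (A_op v) (A_op v) (A_gen * y)"
          using m by (rule A)
        have Bm: "tracks (e + 4) (?B v) (?B' v) (B_gen * y)"
          using m by (rule B) (use e n in simp)
        have Cm: "tracks (e + 6) (?C v) (?C' v) (C_gen * y)"
          using m by (rule C) (use e n in simp)
        have BBm: "tracks (e + 4 + 4) (?B (?B v)) (?B' (?B' v)) (B_gen * (B_gen * y))"
          using Bm by (rule B) (use e n in simp)
        have BAm: "tracks (e + 3 + 4) (?B (A_op v)) (?B' (A_op v)) (B_gen * (A_gen * y))"
          using Am by (rule B) (use e n in simp)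
        \<comment> \<open>The call that may stay in the same total degree, as \<open>e + 10\<close>
          can equal \<open>d + 6\<close>; the extra unit in the fuel bound of C pays for it.\<close>
        have BCm: "tracks (e + 6 + 4) (?B (?C v)) (?B' (?C' v)) (B_gen * (C_gen * y))"
          using Cm by (rule B) (use e n in simp)
        have eq: "pbw_monomial (0, Suc b, \<gamma>) = B_gen * y"
          by (simp add: y_def pbw_monomial_def mult.assoc)
        show ?thesis
          unfolding fields \<alpha> \<beta> approx_vmon next_C.simps eq agen_relations(3) rhs_BC_def v_def[symmetric]
          by (intro tracks_add tracks_diff tracks_scale; rule tracks_mono,
              rule BBm A[OF Bm] BAm A[OF A[OF A[OF m]]] A[OF Am] BCm Bm Am m) (use e in simp_all)
      next
        case \<beta>: 0
        have "tracks (d + 6) (vmon (0, 0, Suc \<gamma>)) (vmon (0, 0, Suc \<gamma>)) (pbw_monomial (0, 0, Suc \<gamma>))"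
          using k \<alpha> \<beta> by (intro tracks_vmon) simp
        then show ?thesis using \<alpha> \<beta> by (simp add: approx_vmon pbw_monomial_def)
      qed
    qed
  qed
  show ?case
  proof (intro conjI allI impI)
    fix d v
    assume "2 * (d + 4) < Suc n" "v \<in> pbw_filt d"
    then show "tracks (d + 4) (approx_B (Suc n) v) (approx_B (Suc (Suc n)) v) (B_gen * pbw_eval v)"
      by (intro tracks_linear[where d = d] approx_linear B_vmon)
  next
    fix d v
    assume "2 * (d + 6) + 1 < Suc n" "v \<in> pbw_filt d"
    then show "tracks (d + 6) (approx_C (Suc n) v) (approx_C (Suc (Suc n)) v) (C_gen * pbw_eval v)"
      by (intro tracks_linear[where d = d] approx_linear C_vmon)
  qed
qed

section \<open>The operators without fuel and their recursion\<close>

definition B_op :: operator where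
  "B_op = lin_ext pbw_scale (\<lambda>k. approx_B (2 * vdeg k + 9) (vmon k))"

text \<open>The offsets 9 for B and 14 for C give the least fuel above
  \<open>2 * (vdeg k + 4)\<close> and \<open>2 * (vdeg k + 6) + 1\<close>.\<close>

definition C_op :: operator where
  "C_op = lin_ext pbw_scale (\<lambda>k. approx_C (2 * vdeg k + 14) (vmon k))"

lemma B_op_linear:
  "B_op (u + v) = B_op u + B_op v" "B_op (u - v) = B_op u - B_op v"
  "B_op (coef p * v) = coef p * B_op v" "B_op 0 = 0"
  by (simp_all only: B_op_def pbw.lin_ext_add pbw.lin_ext_diff pbw_lin_ext_scale pbw.lin_ext_0)

lemma C_op_linear:
  "C_op (u + v) = C_op u + C_op v" "C_op (u - v) = C_op u - C_op v"
  "C_op (coef p * v) = coef p * C_op v" "C_op 0 = 0"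
  by (simp_all only: C_op_def pbw.lin_ext_add pbw.lin_ext_diff pbw_lin_ext_scale pbw.lin_ext_0)

lemmas approx_B_tracks = approx_tracks[THEN conjunct1, rule_format]
lemmas approx_C_tracks = approx_tracks[THEN conjunct2, rule_format]

text \<open>Above the bound, \<open>tracks\<close> equates the values for consecutive amounts of
  fuel; induction chains these equalities.\<close>

lemma approx_B_stable:
  assumes "v \<in> pbw_filt d" "2 * (d + 4) < n" "n \<le> m"
  shows "approx_B m v = approx_B n v"
  using assms(3)
proof (induction m rule: dec_induct)
  case (step k)
  then show ?case using assms approx_B_tracks[of d k v] by (simp add: tracks_def)
qed simp

lemma approx_C_stable:
  assumes "v \<in> pbw_filt d" "2 * (d + 6) + 1 < n" "n \<le> m"
  shows "approx_C m v = approx_C n v"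
  using assms(3)
proof (induction m rule: dec_induct)
  case (step k)
  then show ?case using assms approx_C_tracks[of d k v] by (simp add: tracks_def)
qed simp

lemma B_op_eq_approx:
  assumes "v \<in> pbw_filt d" "2 * (d + 4) < n"
  shows "B_op v = approx_B n v"
  using assms(1)
proof (induction rule: pbw_filt_induct)
  case (vmon k)
  have "approx_B n (vmon k) = approx_B (2 * vdeg k + 9) (vmon k)"
    by (rule approx_B_stable[OF vmon_in_pbw_filt[OF order_refl]]) (use assms(2) vmon in simp_all)
  then show ?case by (simp add: B_op_def pbw_lin_ext_vmon)
qed (simp_all add: B_op_linear approx_linear)

lemma C_op_eq_approx:
  assumes "v \<in> pbw_filt d" "2 * (d + 6) + 1 < n"
  shows "C_op v = approx_C n v"
  using assms(1)
proof (induction rule: pbw_filt_induct)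
  case (vmon k)
  have "approx_C n (vmon k) = approx_C (2 * vdeg k + 14) (vmon k)"
    by (rule approx_C_stable[OF vmon_in_pbw_filt[OF order_refl]]) (use assms(2) vmon in simp_all)
  then show ?case by (simp add: C_op_def pbw_lin_ext_vmon)
qed (simp_all add: C_op_linear approx_linear)

lemma pbw_filt_exhaust: "\<exists>d. v \<in> pbw_filt d"
proof (induction v rule: vmon_induct)
  case (add u v)
  then obtain d e where "u \<in> pbw_filt d" "v \<in> pbw_filt e" by auto
  then have "u \<in> pbw_filt (max d e)" "v \<in> pbw_filt (max d e)"
    by (auto intro: pbw_filt_mono)
  then show ?case unfolding pbw_filt_def by (blast intro: pbw.span_add)
next
  case (scale p v)
  then show ?case unfolding pbw_filt_def by (blast intro: pbw.span_scale)
next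
  case (vmon k)
  show ?case by (blast intro: vmon_in_pbw_filt)
qed

lemma B_op_filt: "v \<in> pbw_filt d \<Longrightarrow> B_op v \<in> pbw_filt (d + 4)"
  using approx_B_tracks[of d "2 * d + 9" v] B_op_eq_approx[of v d "2 * d + 9"] by (simp add: tracks_def)

lemma C_op_filt: "v \<in> pbw_filt d \<Longrightarrow> C_op v \<in> pbw_filt (d + 6)"
  using approx_C_tracks[of d "2 * d + 14" v] C_op_eq_approx[of v d "2 * d + 14"] by (simp add: tracks_def)

lemma pbw_eval_B_op: "pbw_eval (B_op v) = B_gen * pbw_eval v"
proof -
  obtain d where "v \<in> pbw_filt d" using pbw_filt_exhaust by blast
  then show ?thesis
    using approx_B_tracks[of d "2 * d + 9" v] B_op_eq_approx[of v d "2 * d + 9"] by (simp add: tracks_def)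
qed

lemma pbw_eval_C_op: "pbw_eval (C_op v) = C_gen * pbw_eval v"
proof -
  obtain d where "v \<in> pbw_filt d" using pbw_filt_exhaust by blast
  then show ?thesis
    using approx_C_tracks[of d "2 * d + 14" v] C_op_eq_approx[of v d "2 * d + 14"] by (simp add: tracks_def)
qed

text \<open>The recursion is unfolded once at a finite amount of fuel that still leaves every
  recursive call its final value.\<close>

lemma B_op_vmon: "B_op (vmon k) = next_B B_op C_op k"
proof -
  obtain \<alpha> \<beta> \<gamma> where k: "k = (\<alpha>, \<beta>, \<gamma>)" by (cases k)
  \<comment> \<open>Enough for B and C on arguments of degree \<open>vdeg k\<close>:
    \<open>2 * (vdeg k + 6) + 1 < n\<close>.\<close>
  define n where "n = 2 * vdeg k + 14"
  \<comment> \<open>Truncated subtraction gives one statement for both forms of the first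
    exponent.\<close>
  have v: "vmon (\<alpha> - 1, \<beta>, \<gamma>) \<in> pbw_filt (vdeg k)"
    by (rule vmon_in_pbw_filt) (simp add: k)
  have "B_op (vmon k) = approx_B (Suc n) (vmon k)"
    by (rule B_op_eq_approx[OF vmon_in_pbw_filt[OF order_refl]]) (simp add: n_def)
  also have "\<dots> = next_B (approx_B n) (approx_C n) k"
    by (rule approx_vmon)
  also have "\<dots> = next_B B_op C_op k"
    using B_op_eq_approx[OF v, of n] C_op_eq_approx[OF v, of n]
    by (cases \<alpha>) (simp_all add: k n_def)
  finally show ?thesis .
qed

lemma C_op_vmon: "C_op (vmon k) = next_C B_op C_op k"
proof -
  obtain \<alpha> \<beta> \<gamma> where k: "k = (\<alpha>, \<beta>, \<gamma>)" by (cases k)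
  \<comment> \<open>The nested call applies B to an output of C, of degree up to
    \<open>vdeg k + 6\<close>; the fuel covers both operators there, as
    \<open>2 * (vdeg k + 6 + 6) + 1 < n\<close>.\<close>
  define n where "n = 2 * vdeg k + 26"
  have v: "vmon (\<alpha> - 1, \<beta>, \<gamma>) \<in> pbw_filt (vdeg k)" "vmon (0, \<beta> - 1, \<gamma>) \<in> pbw_filt (vdeg k)"
    by (auto intro!: vmon_in_pbw_filt simp: k)
  have n: "B_op x = approx_B n x" "C_op x = approx_C n x"
    if "x \<in> pbw_filt (vdeg k + 6)" for x
    by (rule B_op_eq_approx[OF that] C_op_eq_approx[OF that], simp add: n_def)+
  have eqs: "B_op x = approx_B n x" "C_op x = approx_C n x" "B_op (A_op x) = approx_B n (A_op x)"
      "B_op (B_op x) = approx_B n (B_op x)" "B_op (C_op x) = approx_B n (C_op x)"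
    if x: "x \<in> pbw_filt (vdeg k)" for x
    by (rule n, rule pbw_filt_mono, rule x x_var_mult_in_pbw_filt[OF x] B_op_filt[OF x] C_op_filt[OF x],
        simp)+
  have "C_op (vmon k) = approx_C (Suc n) (vmon k)"
    by (rule C_op_eq_approx[OF vmon_in_pbw_filt[OF order_refl]]) (simp add: n_def)
  also have "\<dots> = next_C (approx_B n) (approx_C n) k"
    by (rule approx_vmon)
  also have "\<dots> = next_C B_op C_op k"
    using eqs[OF v(1)] eqs[OF v(2)]
    by (cases \<alpha>; cases \<beta>) (simp_all add: k rhs_AC_def rhs_BC_def)
  finally show ?thesis .
qed

text \<open>Moves coefficients outwards; full AC rewriting would also permute the arguments of the
  operators.\<close>

lemmas op_simps = B_op_linear C_op_linear distrib_left right_diff_distrib rhs_AC_def rhs_BC_def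
  mult.left_commute[of x_var "coef _"] mult.left_commute[of "coef _" "coef _"]

text \<open>On a basis monomial this is the recursion itself, because \<open>x_var\<close> only
  raises the first exponent; linearity gives the rest. The same holds for
  \<open>C_op_x_var\<close>.\<close>

lemma B_op_x_var: "B_op (A_op v) = A_op (B_op v) - C_op v"
proof (induction v rule: vmon_induct)
  case (vmon k)
  show ?case by (cases k) (simp add: x_var_mult_vmon B_op_vmon[of "(Suc _, _, _)"])
qed (simp only: op_simps; simp add: algebra_simps)+

lemma C_op_x_var: "C_op (A_op v) = A_op (C_op v) - rhs_AC pbw_scale A_op B_op v"
proof (induction v rule: vmon_induct)
  case (vmon k)
  show ?case by (cases k) (simp add: x_var_mult_vmon C_op_vmon[of "(Suc _, _, _)"])
qed (simp only: op_simps; simp add: algebra_simps)+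

text \<open>Given the first two relations, the Jacobi identity says that the defect of the third
  commutes with \<open>A\<close>.\<close>

lemma C_op_B_op: "C_op (B_op v) = B_op (C_op v) - rhs_BC pbw_scale A_op B_op v"
proof (induction v rule: vmon_induct)
  case (vmon k)
  show ?case
  proof (cases k)
    case [simp]: (fields \<alpha> \<beta> \<gamma>)
    show ?thesis unfolding fields
    proof (induction \<alpha>)
      case 0
      \<comment> \<open>Without a leading A, B only raises the second exponent, and the claim is the
        recursion for C.\<close>
      then show ?case by (simp add: B_op_vmon[of "(0, _, _)"] C_op_vmon[of "(0, Suc _, _)"])
    next
      case (Suc \<alpha>)
      \<comment> \<open>Moving A to the front and using the induction hypothesis leaves
        [A, \<open>rhs_BC\<close>] = [B, \<open>rhs_AC\<close>]. As [A,B] = C, both sides are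
        -a1{B,C} - a2{A,C} - a5 C.\<close>
      then show ?case unfolding x_var_mult_vmon[symmetric]
        by (simp only: op_simps B_op_x_var C_op_x_var) (simp add: algebra_simps)
    qed
  qed
qed (simp only: op_simps; simp add: algebra_simps)+

section \<open>The normal form map\<close>

fun gen_op :: "gen \<Rightarrow> operator" where
  "gen_op GenA = A_op"
| "gen_op GenB = B_op"
| "gen_op GenC = C_op"

lemma gen_op_linear:
  "gen_op g (u + v) = gen_op g u + gen_op g v"
  "gen_op g (coef p * v) = coef p * gen_op g v"
  by (cases g; simp only: gen_op.simps op_simps)+

lemma gen_op_filt: "v \<in> pbw_filt d \<Longrightarrow> gen_op g v \<in> pbw_filt (d + gen_degree g)"
  by (cases g) (simp_all add: x_var_mult_in_pbw_filt B_op_filt C_op_filt)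

lemma pbw_eval_gen_op: "pbw_eval (gen_op g v) = gen_agen g * pbw_eval v"
  by (cases g) (simp_all add: pbw_eval_x_var pbw_eval_B_op pbw_eval_C_op)

text \<open>A left action: the last letter of a word acts first, hence \<open>foldr\<close>.\<close>

definition rep :: "free_alg \<Rightarrow> operator" where
  "rep x v = lin_ext pbw_scale (\<lambda>w. foldr gen_op (letters w) v) x"

lemma rep_linear:
  "rep (x + y) v = rep x v + rep y v"
  "rep (x - y) v = rep x v - rep y v"
  "rep 0 v = 0"
  by (simp_all only: rep_def pbw.lin_ext_add pbw.lin_ext_diff pbw.lin_ext_0)

lemma rep_single: "rep (Poly_Mapping.single w p) v = coef p * foldr gen_op (letters w) v"
  by (simp only: rep_def pbw.lin_ext_single)

lemma rep_const: "rep (const p) v = coef p * v"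
  by (simp add: const_def rep_single zero_gword_def)

lemma rep_letter: "rep (letter g) v = gen_op g v"
  by (simp add: letter_def rep_single coef_1)

lemma foldr_gen_op_linear:
  "foldr gen_op w (u + v) = foldr gen_op w u + foldr gen_op w v"
  "foldr gen_op w (coef p * v) = coef p * foldr gen_op w v"
  by (induction w) (simp_all add: gen_op_linear)

lemma rep_operator_linear:
  "rep x (u + v) = rep x u + rep x v"
  "rep x (coef p * v) = coef p * rep x v"
  by (induction x rule: poly_mapping_single_induct;
      simp only: rep_linear rep_single foldr_gen_op_linear distrib_left add.assoc add.left_commute
        pbw.scale_left_commute)+

lemma rep_mult: "rep (x * y) v = rep x (rep y v)"
proof (induction x rule: poly_mapping_single_induct)
  case (add x x')
  then show ?case by (simp add: distrib_right rep_linear)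
next
  case (single w p)
  show ?case
  proof (induction y rule: poly_mapping_single_induct)
    case (add y y')
    then show ?case by (simp add: distrib_left rep_linear rep_operator_linear)
  next
    case (single w' q)
    show ?case
      by (simp add: mult_single rep_single foldr_gen_op_linear plus_gword_def)
  qed
qed

text \<open>The operators satisfy the three relations, so relators act as zero, and the annihilator
  of a module is a two-sided ideal. Arbitrary \<open>v\<close> serves right multiples, where
  \<open>x\<close> acts on \<open>rep u v\<close>.\<close>

lemma rep_rel_ideal: "x \<in> rel_ideal \<Longrightarrow> rep x v = 0"
proof (induction arbitrary: v rule: rel_ideal.induct)
  case (relator r)
  then show ?case
    by (auto simp: relators_def Let_def commutator_def anticommutator_def power2_eq_square
        power3_eq_cube rep_linear rep_mult rep_const rep_letter B_op_x_var C_op_x_var C_op_B_op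
        rhs_AC_def rhs_BC_def)
next
  case (mult_left x u)
  \<comment> \<open>Additivity at two zero vectors yields \<open>rep u 0 = 0\<close>.\<close>
  then show ?case using rep_operator_linear(1)[of u 0 0] by (simp add: rep_mult)
qed (simp_all add: rep_linear rep_mult)

lift_definition pbw_coord :: "agen \<Rightarrow> pbw_module" is "\<lambda>x. rep x (vmon (0, 0, 0))"
  using rep_rel_ideal by (fastforce simp: rel_cong_def rep_linear)

lemma pbw_coord_linear:
  "pbw_coord (x + y) = pbw_coord x + pbw_coord y"
  "pbw_coord (x - y) = pbw_coord x - pbw_coord y"
  "pbw_coord (scale p x) = coef p * pbw_coord x"
  "pbw_coord 0 = 0"
  by (transfer; simp add: rep_linear rep_mult rep_const)+

lemma pbw_coord_mult: "pbw_coord (gen_agen g * x) = gen_op g (pbw_coord x)"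
  by transfer (simp add: rep_mult rep_letter)

lemma pbw_coord_1: "pbw_coord 1 = vmon (0, 0, 0)"
proof -
  have "rep 1 v = v" for v
    using rep_const[of 1 v] by (simp add: const_one coef_1)
  then show ?thesis by transfer simp
qed

text \<open>When the monomial is built from its right end, each letter meets a vector on which it
  acts without rewriting: C on powers of C, B on monomials without A, and A anywhere.\<close>

lemma pbw_coord_pbw_monomial: "pbw_coord (pbw_monomial k) = vmon k"
proof (cases k)
  case (fields \<alpha> \<beta> \<gamma>)
  have C: "pbw_coord (C_gen ^ \<gamma>) = vmon (0, 0, \<gamma>)"
    by (induction \<gamma>) (simp_all add: pbw_coord_1 pbw_coord_mult C_op_vmon)
  have B: "pbw_coord (B_gen ^ \<beta> * C_gen ^ \<gamma>) = vmon (0, \<beta>, \<gamma>)"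
    by (induction \<beta>) (simp_all add: C pbw_coord_mult B_op_vmon mult.assoc)
  have "pbw_coord (A_gen ^ \<alpha> * (B_gen ^ \<beta> * C_gen ^ \<gamma>)) = vmon (\<alpha>, \<beta>, \<gamma>)"
    by (induction \<alpha>) (simp_all add: B pbw_coord_mult x_var_mult_vmon mult.assoc)
  then show ?thesis by (simp add: fields pbw_monomial_def mult.assoc)
qed

lemma pbw_coord_pbw_eval: "pbw_coord (pbw_eval v) = v"
  by (induction v rule: vmon_induct)
    (simp_all add: pbw_eval_simps pbw_coord_linear pbw_coord_pbw_monomial)

lemma pbw_eval_foldr:
  "pbw_eval (foldr gen_op w (vmon (0, 0, 0))) = prod_list (map gen_agen w)"
  by (induction w) (simp_all add: pbw_eval_simps pbw_monomial_def pbw_eval_gen_op)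

lemma abs_agen_single:
  "abs_agen (Poly_Mapping.single (Word w) p) = scale p (prod_list (map gen_agen w))"
proof (induction w arbitrary: p)
  case Nil
  show ?case by (simp add: one_agen.abs_eq scale.abs_eq const_def zero_gword_def)
next
  case (Cons g w)
  have "Poly_Mapping.single (Word (g # w)) p = letter g * Poly_Mapping.single (Word w) p"
    by (simp add: letter_def mult_single plus_gword_def)
  then show ?case
    by (simp flip: times_agen.abs_eq add: Cons gen_agen.abs_eq[symmetric] scale_mult_right)
qed

text \<open>A word acting on the unit vector evaluates back to that word, because each
  \<open>gen_op\<close> lifts a left multiplication. This yields spanning.\<close>

lemma pbw_eval_pbw_coord: "pbw_eval (pbw_coord y) = y"
proof (induction y rule: agen.abs_induct)
  fix x
  show "pbw_eval (pbw_coord (abs_agen x)) = abs_agen x"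
  proof (induction x rule: poly_mapping_single_induct)
    case (add u v)
    then show ?case by (simp flip: plus_agen.abs_eq add: pbw_coord_linear pbw_eval_simps)
  next
    case (single w p)
    obtain gs where w: "w = Word gs" by (cases w)
    have "pbw_coord (abs_agen (Poly_Mapping.single w p)) = coef p * foldr gen_op gs (vmon (0, 0, 0))"
      by (simp add: pbw_coord.abs_eq rep_single w)
    then show ?case
      by (simp add: w pbw_eval_simps pbw_eval_foldr abs_agen_single)
  qed
qed

section \<open>Independence and spanning of the ordered monomials\<close>

lemma pbw_coord_sum: "pbw_coord (\<Sum>i\<in>I. f i) = (\<Sum>i\<in>I. pbw_coord (f i))"
  by (induction I rule: infinite_finite_induct) (simp_all add: pbw_coord_linear)

lemma inj_pbw_monomial: "inj pbw_monomial"
proof (rule injI)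
  fix k l assume "pbw_monomial k = pbw_monomial l"
  then have "vmon k = vmon l" by (metis pbw_coord_pbw_monomial)
  then show "k = l" unfolding vmon_def by (metis keys_single singleton_inject zero_neq_one)
qed

lemma lookup_coef_mult: "Poly_Mapping.lookup (coef p * v) k = p * Poly_Mapping.lookup v k"
  by (simp add: coef_def lookup_single_0_mult)

lemma lookup_vmon: "Poly_Mapping.lookup (vmon k) l = (if k = l then 1 else 0)"
  by (simp add: vmon_def lookup_single when_def)

lemma independent_pbw_monomial: "agen.independent (range pbw_monomial)"
  unfolding agen.independent_explicit_module
proof (intro allI impI)
  fix t u y
  assume t: "finite t" "t \<subseteq> range pbw_monomial" "(\<Sum>y\<in>t. scale (u y) y) = 0" "y \<in> t"
  then obtain k where k: "y = pbw_monomial k" by blast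
  \<comment> \<open>The coordinate at \<open>k\<close> isolates the coefficient of \<open>y\<close>,
    since the monomials have the unit vectors as coordinates.\<close>
  have "0 = Poly_Mapping.lookup (pbw_coord (\<Sum>y\<in>t. scale (u y) y)) k"
    using t by (simp add: pbw_coord_linear)
  also have "\<dots> = (\<Sum>z\<in>t. u z * Poly_Mapping.lookup (pbw_coord z) k)"
    by (simp add: pbw_coord_sum lookup_sum pbw_coord_linear lookup_coef_mult)
  also have "\<dots> = (\<Sum>z\<in>t. if z = y then u y else 0)"
    using t(2) by (intro sum.cong) (auto simp: pbw_coord_pbw_monomial lookup_vmon k)
  also have "\<dots> = u y"
    using t by simp
  finally show "u y = 0" by simp
qed

lemma span_pbw_monomial: "agen.span (range pbw_monomial) = UNIV"
proof -
  have "y \<in> agen.span (range pbw_monomial)" for y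
    by (subst pbw_eval_pbw_coord[symmetric], subst pbw_eval_def, unfold lin_ext_def)
      (intro agen.span_sum agen.span_scale agen.span_base rangeI)
  then show ?thesis by blast
qed

section \<open>The filtration\<close>

lemma pbw_filt_iff: "v \<in> pbw_filt d \<longleftrightarrow> (\<forall>k. Poly_Mapping.lookup v k \<noteq> 0 \<longrightarrow> vdeg k \<le> d)"
proof
  assume "v \<in> pbw_filt d"
  then show "\<forall>k. Poly_Mapping.lookup v k \<noteq> 0 \<longrightarrow> vdeg k \<le> d"
  proof (induction rule: pbw_filt_induct)
    case (add u v)
    then show ?case by (metis add_0 lookup_add)
  next
    case (scale p v)
    then show ?case by (metis lookup_coef_mult mult_zero_right)
  qed (auto simp: lookup_vmon)
next
  assume *: "\<forall>k. Poly_Mapping.lookup v k \<noteq> 0 \<longrightarrow> vdeg k \<le> d"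
  have "lin_ext pbw_scale vmon v = v"
    by (induction v rule: vmon_induct)
      (simp_all only: pbw.lin_ext_add pbw_lin_ext_scale pbw_lin_ext_vmon)
  moreover have "lin_ext pbw_scale vmon v \<in> pbw_filt d"
    unfolding lin_ext_def pbw_filt_def using *
    by (intro pbw.span_sum pbw.span_scale pbw.span_base) (auto simp: in_keys_iff)
  ultimately show "v \<in> pbw_filt d" by simp
qed

text \<open>A generator raises the degree of a vector by at most its own degree, which bounds the
  words; conversely an ordered monomial is a word of degree \<open>vdeg\<close>.\<close>

lemma agen_filt_iff:
  "y \<in> agen_filt n \<longleftrightarrow> (\<forall>k. Poly_Mapping.lookup (pbw_coord y) k \<noteq> 0 \<longrightarrow> int (vdeg k) \<le> n)"
proof
  assume "y \<in> agen_filt n"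
  then show "\<forall>k. Poly_Mapping.lookup (pbw_coord y) k \<noteq> 0 \<longrightarrow> int (vdeg k) \<le> n"
    unfolding agen_filt_def
  proof (induction rule: agen.span_induct)
    case base
    show ?case
      by (rule agen.subspaceI; clarsimp simp only: mem_Collect_eq pbw_coord_linear lookup_add
            lookup_coef_mult lookup_zero; metis add_0 mult_zero_right)
  next
    case (step y)
    then obtain w where w: "y = prod_list (map gen_agen w)" "int (sum_list (map gen_degree w)) \<le> n"
      by blast
    have "foldr gen_op w (vmon (0, 0, 0)) \<in> pbw_filt (sum_list (map gen_degree w))"
    proof (induction w)
      case (Cons g w)
      then show ?case
        using gen_op_filt[OF Cons.IH] by (simp add: add.commute[of "gen_degree g"])
    qed (simp add: vmon_in_pbw_filt)
    then show ?case
      using w(2) unfolding w(1) pbw_eval_foldr[symmetric] pbw_coord_pbw_eval pbw_filt_iff by force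
  qed
next
  assume *: "\<forall>k. Poly_Mapping.lookup (pbw_coord y) k \<noteq> 0 \<longrightarrow> int (vdeg k) \<le> n"
  have "pbw_monomial k \<in> agen_filt n" if "int (vdeg k) \<le> n" for k
  proof (cases k)
    case (fields \<alpha> \<beta> \<gamma>)
    let ?w = "replicate \<alpha> GenA @ replicate \<beta> GenB @ replicate \<gamma> GenC"
    have "pbw_monomial k = prod_list (map gen_agen ?w)" "sum_list (map gen_degree ?w) = vdeg k"
      by (simp_all add: fields pbw_monomial_def mult.assoc prod_list_replicate sum_list_replicate)
    then show ?thesis
      using that unfolding agen_filt_def
      by (intro agen.span_base CollectI exI[of _ ?w] conjI) (simp_all only:)
  qed
  then have "pbw_eval (pbw_coord y) \<in> agen_filt n"
    using * unfolding pbw_eval_def lin_ext_def agen_filt_def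
    by (intro agen.span_sum agen.span_scale) (auto simp: in_keys_iff)
  then show "y \<in> agen_filt n" by (simp add: pbw_eval_pbw_coord)
qed

section \<open>Invariance of rank\<close>

lemma (in abelian_monoid) finsum_swap:
  assumes "finite I" "finite J" "\<And>i j. i \<in> I \<Longrightarrow> j \<in> J \<Longrightarrow> f i j \<in> carrier G"
  shows "(\<Oplus>i\<in>I. \<Oplus>j\<in>J. f i j) = (\<Oplus>j\<in>J. \<Oplus>i\<in>I. f i j)"
  using assms(1,3)
proof (induction I rule: finite_induct)
  case empty
  show ?case by simp
next
  case (insert i I)
  then have "(\<Oplus>j\<in>J. \<Oplus>i\<in>insert i I. f i j) = (\<Oplus>j\<in>J. f i j \<oplus> (\<Oplus>i\<in>I. f i j))"
    by (intro finsum_cong') (auto simp: finsum_insert intro!: finsum_closed)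
  also have "\<dots> = (\<Oplus>j\<in>J. f i j) \<oplus> (\<Oplus>j\<in>J. \<Oplus>i\<in>I. f i j)"
    using insert by (intro finsum_addf) (auto intro!: finsum_closed)
  finally show ?case
    using insert by (simp add: finsum_insert finsum_closed Pi_iff)
qed

context Module.module
begin

lemma finsum_smult_rdistr:
  assumes "finite I" "\<And>i. i \<in> I \<Longrightarrow> a i \<in> carrier R" "x \<in> carrier M"
  shows "(\<Oplus>i\<in>I. a i) \<odot>\<^bsub>M\<^esub> x = (\<Oplus>\<^bsub>M\<^esub>i\<in>I. a i \<odot>\<^bsub>M\<^esub> x)"
  using assms(1,2)
proof (induction I rule: finite_induct)
  case empty
  show ?case using assms by simp
next
  case (insert i I)
  then show ?case using assms(3)
    by (simp add: R.finsum_insert M.finsum_insert Pi_iff smult_l_distr)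
qed

text \<open>Summing over the whole finite set rather than the support allows sums to be exchanged;
  vanishing outside \<open>B\<close> keeps coordinate functions comparable.\<close>

definition is_coords :: "'c set \<Rightarrow> 'c \<Rightarrow> ('c \<Rightarrow> 'a) \<Rightarrow> bool" where
  "is_coords B x c \<longleftrightarrow> (\<forall>b. c b \<in> carrier R) \<and> (\<forall>b. b \<notin> B \<longrightarrow> c b = \<zero>) \<and>
     x = (\<Oplus>\<^bsub>M\<^esub>b\<in>B. c b \<odot>\<^bsub>M\<^esub> b)"

lemma module_basis_iff:
  assumes "finite B"
  shows "module_basis R M B \<longleftrightarrow> B \<subseteq> carrier M \<and> (\<forall>x\<in>carrier M. \<exists>!c. is_coords B x c)"
proof -
  have "((\<forall>b. c b \<in> carrier R) \<and> finite {b. c b \<noteq> \<zero>} \<and> {b. c b \<noteq> \<zero>} \<subseteq> B \<and>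
       x = finsum M (\<lambda>b. c b \<odot>\<^bsub>M\<^esub> b) {b. c b \<noteq> \<zero>}) = is_coords B x c"
    if B: "B \<subseteq> carrier M" for x c
  proof -
    have a: "finsum M (\<lambda>b. c b \<odot>\<^bsub>M\<^esub> b) {b. c b \<noteq> \<zero>} = (\<Oplus>\<^bsub>M\<^esub>b\<in>B. c b \<odot>\<^bsub>M\<^esub> b)"
      if "\<forall>b. c b \<in> carrier R" "{b. c b \<noteq> \<zero>} \<subseteq> B"
      using that B assms by (intro M.add.finprod_mono_neutral_cong_left) auto
    have b: "(\<forall>b. b \<notin> B \<longrightarrow> c b = \<zero>) \<longleftrightarrow> {b. c b \<noteq> \<zero>} \<subseteq> B"
      by auto
    have c: "finite {b. c b \<noteq> \<zero>}" if "{b. c b \<noteq> \<zero>} \<subseteq> B"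
      using that assms by (rule finite_subset)
    show ?thesis
    proof (cases "(\<forall>b. c b \<in> carrier R) \<and> {b. c b \<noteq> \<zero>} \<subseteq> B")
      case True
      then show ?thesis
        using a[OF True[THEN conjunct1] True[THEN conjunct2]] c[OF True[THEN conjunct2]]
        unfolding is_coords_def b by metis
    next
      case False
      then show ?thesis unfolding is_coords_def b by blast
    qed
  qed
  then show ?thesis
    unfolding module_basis_def by (intro conj_cong refl) (simp only:)
qed

text \<open>If the matrices \<open>P\<close> and \<open>Q\<close> express two bases in terms of each other, then
  \<open>P * Q\<close> and \<open>Q * P\<close> are identity matrices, whose traces agree.\<close>

lemma module_basis_trace:
  assumes B: "module_basis R M B" "finite B" and D: "module_basis R M D" "finite D"
  obtains P Q where "\<And>b d. P b d \<in> carrier R" "\<And>d b. Q d b \<in> carrier R"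
    "\<And>b. b \<in> B \<Longrightarrow> (\<Oplus>d\<in>D. P b d \<otimes> Q d b) = \<one>"
    "\<And>d. d \<in> D \<Longrightarrow> (\<Oplus>b\<in>B. Q d b \<otimes> P b d) = \<one>"
proof -
  have BM: "B \<subseteq> carrier M" and DM: "D \<subseteq> carrier M"
    using B D by (auto simp: module_basis_iff)
  have "\<exists>P. \<forall>b\<in>B. is_coords D b (P b)" "\<exists>Q. \<forall>d\<in>D. is_coords B d (Q d)"
    using B D BM DM unfolding module_basis_iff[OF B(2)] module_basis_iff[OF D(2)]
    by (metis subsetD)+
  then obtain P Q where P: "\<And>b. b \<in> B \<Longrightarrow> is_coords D b (P b)"
    and Q: "\<And>d. d \<in> D \<Longrightarrow> is_coords B d (Q d)" by blast
  \<comment> \<open>Stated for fresh sets and matrices, so that it can be used with the two bases in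
    either order.\<close>
  have diag: "(\<Oplus>d\<in>D. P b d \<otimes> Q d b) = \<one>"
    if B: "module_basis R M B" "finite B" and D: "D \<subseteq> carrier M" "finite D"
      and P: "\<And>b. b \<in> B \<Longrightarrow> is_coords D b (P b)" and Q: "\<And>d. d \<in> D \<Longrightarrow> is_coords B d (Q d)"
      and b: "b \<in> B" for B D P Q b
  proof -
    have BM: "B \<subseteq> carrier M" and uniq: "\<And>x. x \<in> carrier M \<Longrightarrow> \<exists>!c. is_coords B x c"
      using B by (auto simp: module_basis_iff)
    have PR: "P b d \<in> carrier R" for d
      using P[OF b] by (simp add: is_coords_def)
    have QR: "d \<in> D \<Longrightarrow> Q d b' \<in> carrier R" for d b'
      using Q by (simp add: is_coords_def)
    have "b = (\<Oplus>\<^bsub>M\<^esub>d\<in>D. P b d \<odot>\<^bsub>M\<^esub> d)"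
      using P[OF b] by (simp add: is_coords_def)
    also have "\<dots> = (\<Oplus>\<^bsub>M\<^esub>d\<in>D. \<Oplus>\<^bsub>M\<^esub>b'\<in>B. (P b d \<otimes> Q d b') \<odot>\<^bsub>M\<^esub> b')"
    proof (rule M.finsum_cong')
      fix d assume d: "d \<in> D"
      have "P b d \<odot>\<^bsub>M\<^esub> d = P b d \<odot>\<^bsub>M\<^esub> (\<Oplus>\<^bsub>M\<^esub>b'\<in>B. Q d b' \<odot>\<^bsub>M\<^esub> b')"
        using Q[OF d] by (simp add: is_coords_def)
      also have "\<dots> = (\<Oplus>\<^bsub>M\<^esub>b'\<in>B. P b d \<odot>\<^bsub>M\<^esub> (Q d b' \<odot>\<^bsub>M\<^esub> b'))"
        using B PR QR[OF d] BM by (intro finsum_smult_ldistr) auto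
      also have "\<dots> = (\<Oplus>\<^bsub>M\<^esub>b'\<in>B. (P b d \<otimes> Q d b') \<odot>\<^bsub>M\<^esub> b')"
        using PR QR[OF d] BM by (intro M.finsum_cong') (auto simp: smult_assoc1)
      finally show "P b d \<odot>\<^bsub>M\<^esub> d = (\<Oplus>\<^bsub>M\<^esub>b'\<in>B. (P b d \<otimes> Q d b') \<odot>\<^bsub>M\<^esub> b')" .
    qed (use PR QR BM in \<open>auto intro!: M.finsum_closed\<close>)
    also have "\<dots> = (\<Oplus>\<^bsub>M\<^esub>b'\<in>B. \<Oplus>\<^bsub>M\<^esub>d\<in>D. (P b d \<otimes> Q d b') \<odot>\<^bsub>M\<^esub> b')"
      using B D PR QR BM by (intro M.finsum_swap) auto
    also have "\<dots> = (\<Oplus>\<^bsub>M\<^esub>b'\<in>B. (\<Oplus>d\<in>D. P b d \<otimes> Q d b') \<odot>\<^bsub>M\<^esub> b')"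
      using D PR QR BM by (intro M.finsum_cong' finsum_smult_rdistr[symmetric])
        (auto intro!: R.finsum_closed)
    also have "\<dots> = (\<Oplus>\<^bsub>M\<^esub>b'\<in>B. (if b' \<in> B then \<Oplus>d\<in>D. P b d \<otimes> Q d b' else \<zero>) \<odot>\<^bsub>M\<^esub> b')"
      using PR QR BM by (intro M.finsum_cong') (auto intro!: R.finsum_closed)
    finally have "is_coords B b (\<lambda>b'. if b' \<in> B then \<Oplus>d\<in>D. P b d \<otimes> Q d b' else \<zero>)"
      using PR QR by (auto simp: is_coords_def intro!: R.finsum_closed)
    \<comment> \<open>The Kronecker delta is a second coordinate function of \<open>b\<close>;
      uniqueness then gives the diagonal entry.\<close>
    moreover have "is_coords B b (\<lambda>b'. if b' = b then \<one> else \<zero>)"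
    proof -
      have "(\<Oplus>\<^bsub>M\<^esub>b'\<in>B. (if b' = b then \<one> else \<zero>) \<odot>\<^bsub>M\<^esub> b') = (\<Oplus>\<^bsub>M\<^esub>b'\<in>B. if b = b' then b' else \<zero>\<^bsub>M\<^esub>)"
        using BM by (intro M.finsum_cong') auto
      also have "\<dots> = b" using b BM B by (subst M.add.finprod_singleton) auto
      finally show ?thesis using b by (auto simp: is_coords_def)
    qed
    moreover have "b \<in> carrier M" using b BM by auto
    ultimately have "(\<lambda>b'. if b' \<in> B then \<Oplus>d\<in>D. P b d \<otimes> Q d b' else \<zero>) = (\<lambda>b'. if b' = b then \<one> else \<zero>)"
      using uniq by blast
    from fun_cong[OF this, of b] show ?thesis using b by simp
  qed
  show ?thesis
  \<comment> \<open>Extension by zero puts the entries in the ring for all indices.\<close>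
  proof (rule that[of "\<lambda>b d. if b \<in> B then P b d else \<zero>" "\<lambda>d b. if d \<in> D then Q d b else \<zero>"])
    show "(if b \<in> B then P b d else \<zero>) \<in> carrier R" for b d
      using P by (auto simp: is_coords_def)
    show "(if d \<in> D then Q d b else \<zero>) \<in> carrier R" for b d
      using Q by (auto simp: is_coords_def)
    show "(\<Oplus>d\<in>D. (if b \<in> B then P b d else \<zero>) \<otimes> (if d \<in> D then Q d b else \<zero>)) = \<one>" if b: "b \<in> B" for b
    proof -
      have "(\<Oplus>d\<in>D. (if b \<in> B then P b d else \<zero>) \<otimes> (if d \<in> D then Q d b else \<zero>)) = (\<Oplus>d\<in>D. P b d \<otimes> Q d b)"
        using b P Q by (intro R.finsum_cong') (auto simp: is_coords_def)
      then show ?thesis using diag[OF B DM D(2) P Q b] by simp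
    qed
    show "(\<Oplus>b\<in>B. (if d \<in> D then Q d b else \<zero>) \<otimes> (if b \<in> B then P b d else \<zero>)) = \<one>" if d: "d \<in> D" for d
    proof -
      have "(\<Oplus>b\<in>B. (if d \<in> D then Q d b else \<zero>) \<otimes> (if b \<in> B then P b d else \<zero>)) = (\<Oplus>b\<in>B. Q d b \<otimes> P b d)"
        using d P Q by (intro R.finsum_cong') (auto simp: is_coords_def)
      then show ?thesis using diag[OF D BM B(2) Q P d] by simp
    qed
  qed
qed

end

lemma cpoly_ring_sel:
  "carrier cpoly_ring = UNIV" "x \<otimes>\<^bsub>cpoly_ring\<^esub> y = x * y" "\<one>\<^bsub>cpoly_ring\<^esub> = 1"
  "\<zero>\<^bsub>cpoly_ring\<^esub> = 0" "x \<oplus>\<^bsub>cpoly_ring\<^esub> y = x + y"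
  by (simp_all add: cpoly_ring_def)

lemma finsum_cpoly_ring:
  assumes "finite I"
  shows "finsum cpoly_ring f I = sum f I"
proof -
  interpret cring cpoly_ring by (rule cring_cpoly_ring)
  show ?thesis using assms
    by (induction I rule: finite_induct) (simp_all add: finsum_insert cpoly_ring_sel)
qed

text \<open>The two traces are the cardinalities as constants of the coefficient ring; they agree by
  exchanging sums and commutativity.\<close>

lemma card_module_basis_unique:
  assumes "Module.module cpoly_ring M"
    and B: "module_basis cpoly_ring M B" "finite B" and D: "module_basis cpoly_ring M D" "finite D"
  shows "card B = card D"
proof -
  interpret Module.module cpoly_ring M by fact
  obtain P Q where PQ: "\<And>b. b \<in> B \<Longrightarrow> (\<Oplus>\<^bsub>cpoly_ring\<^esub>d\<in>D. P b d \<otimes>\<^bsub>cpoly_ring\<^esub> Q d b) = \<one>\<^bsub>cpoly_ring\<^esub>"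
    "\<And>d. d \<in> D \<Longrightarrow> (\<Oplus>\<^bsub>cpoly_ring\<^esub>b\<in>B. Q d b \<otimes>\<^bsub>cpoly_ring\<^esub> P b d) = \<one>\<^bsub>cpoly_ring\<^esub>"
    by (rule module_basis_trace[OF B D]) blast
  note PQ = PQ[unfolded finsum_cpoly_ring[OF B(2)] finsum_cpoly_ring[OF D(2)] cpoly_ring_sel]
  have "of_nat (card B) = (\<Sum>b\<in>B. 1 :: cpoly)"
    by simp
  also have "\<dots> = (\<Sum>b\<in>B. \<Sum>d\<in>D. P b d * Q d b)"
    by (rule sum.cong[OF refl]) (simp only: PQ)
  also have "\<dots> = (\<Sum>d\<in>D. \<Sum>b\<in>B. Q d b * P b d)"
    by (subst sum.swap) (simp only: mult.commute)
  also have "\<dots> = (\<Sum>d\<in>D. 1)"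
    by (rule sum.cong[OF refl]) (simp only: PQ)
  also have "\<dots> = of_nat (card D)"
    by simp
  \<comment> \<open>Characteristic zero turns the equality of constants into one of natural
    numbers.\<close>
  finally show ?thesis by (simp only: of_nat_eq_iff)
qed

lemma module_rank_eq:
  assumes "Module.module cpoly_ring M" "module_basis cpoly_ring M B" "finite B"
  shows "module_rank cpoly_ring M = card B"
  unfolding module_rank_def free_of_rank_def using assms
  by (intro the_equality) (auto dest: card_module_basis_unique)

section \<open>The Hilbert series\<close>

lemma finite_mult_le: "m > 0 \<Longrightarrow> finite {i :: nat. m * i \<le> n}"
  by (rule finite_subset[of _ "{..n}"]) (auto intro: order_trans[rotated])

text \<open>The hypothesis says that \<open>F\<close> is \<open>G\<close> times the geometric series
  in \<open>fps_X ^ m\<close>.\<close>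

lemma fps_mult_geometric_nth:
  fixes F :: "'a::comm_ring_1 fps"
  assumes "m > 0" "\<And>n. fps_nth F n = (\<Sum>i\<in>{i. m * i \<le> n}. fps_nth G (n - m * i))"
  shows "F * (1 - fps_X ^ m) = G"
proof (rule fps_ext)
  fix n
  have fin: "finite {i. m * i \<le> k}" for k
    using assms(1) by (rule finite_mult_le)
  have "fps_nth (F * (1 - fps_X ^ m)) n = fps_nth F n - (if n < m then 0 else fps_nth F (n - m))"
    by (simp add: right_diff_distrib fps_X_power_mult_right_nth)
  also have "\<dots> = fps_nth G n"
  proof (cases "n < m")
    case True
    have "m * i \<le> n \<longleftrightarrow> i = 0" for i
      using True by (cases i) auto
    then show ?thesis using True assms(2)[of n] by simp
  next
    case False
    \<comment> \<open>The index 0 contributes the coefficient of \<open>G\<close>; shifting the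
      others by one gives the coefficient of \<open>F\<close> at \<open>n - m\<close>.\<close>
    have "{i. m * i \<le> n} = insert 0 (Suc ` {i. m * i \<le> n - m})"
    proof (intro Set.set_eqI iffI)
      fix i assume "i \<in> {i. m * i \<le> n}"
      then show "i \<in> insert 0 (Suc ` {i. m * i \<le> n - m})"
        using False by (cases i) auto
    qed (use False in auto)
    then have "fps_nth F n = fps_nth G n + (\<Sum>i\<in>{i. m * i \<le> n - m}. fps_nth G (n - (m + m * i)))"
      unfolding assms(2)[of n] by (simp add: fin sum.reindex)
    also have "(\<Sum>i\<in>{i. m * i \<le> n - m}. fps_nth G (n - (m + m * i))) = fps_nth F (n - m)"
      by (simp add: assms(2)[of "n - m"])
    finally show ?thesis using False by simp
  qed
  finally show "fps_nth (F * (1 - fps_X ^ m)) n = fps_nth G n" .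
qed

text \<open>Meant for finite fibres, since \<open>card\<close> is 0 on infinite sets.\<close>

definition counting_fps :: "('b \<Rightarrow> nat) \<Rightarrow> rat fps" where
  "counting_fps f = Abs_fps (\<lambda>n. of_nat (card {x. f x = n}))"

text \<open>The fibre over \<open>n\<close> splits by its first component \<open>i\<close> into the
  fibres of \<open>f\<close> over \<open>n - m * i\<close>, so a further weight \<open>m\<close>
  contributes a geometric factor.\<close>

lemma
  assumes "m > 0" "\<And>n. finite {x. f x = n}"
  shows counting_fps_Pair: "counting_fps (\<lambda>(i, x). m * i + f x) * (1 - fps_X ^ m) = counting_fps f"
    and finite_fibre_Pair: "finite {y. (\<lambda>(i, x). m * i + f x) y = n}"
proof -
  have eq: "{y. (\<lambda>(i, x). m * i + f x) y = n} = (SIGMA i:{i. m * i \<le> n}. {x. f x = n - m * i})" for n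
    by auto
  have fin: "finite {i. m * i \<le> n}" for n
    using assms(1) by (rule finite_mult_le)
  show "finite {y. (\<lambda>(i, x). m * i + f x) y = n}"
    unfolding eq using fin assms(2) by blast
  show "counting_fps (\<lambda>(i, x). m * i + f x) * (1 - fps_X ^ m) = counting_fps f"
    by (rule fps_mult_geometric_nth[OF assms(1)])
      (simp only: counting_fps_def fps_nth_Abs_fps eq, simp add: fin assms(2))
qed

lemma counting_fps_mult:
  assumes "m > 0"
  shows "counting_fps ((*) m) * (1 - fps_X ^ m) = 1"
proof (rule fps_mult_geometric_nth[OF assms])
  fix n
  have fin: "finite {i. m * i \<le> n}"
    using assms by (rule finite_mult_le)
  have "(\<Sum>i\<in>{i. m * i \<le> n}. fps_nth (1 :: rat fps) (n - m * i)) = (\<Sum>i\<in>{i. m * i = n}. 1)"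
    by (rule sum.mono_neutral_cong_right) (use fin in auto)
  then show "fps_nth (counting_fps ((*) m)) n = (\<Sum>i\<in>{i. m * i \<le> n}. fps_nth 1 (n - m * i))"
    by (simp add: counting_fps_def)
qed

lemma vdeg_eq: "vdeg = (\<lambda>(\<alpha>, k). 3 * \<alpha> + (\<lambda>(\<beta>, \<gamma>). 4 * \<beta> + 6 * \<gamma>) k)"
  by auto

lemma finite_fibre_mult: "m > 0 \<Longrightarrow> finite {i :: nat. m * i = n}"
  by (rule finite_subset[OF _ finite_mult_le[of m n]]) auto

lemma finite_vdeg: "finite {k. vdeg k = n}"
  unfolding vdeg_eq by (intro finite_fibre_Pair finite_fibre_mult) simp_all

lemma counting_fps_vdeg:
  "counting_fps vdeg = 1 / ((1 - fps_X ^ 3) * (1 - fps_X ^ 4) * (1 - fps_X ^ 6))"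
proof -
  let ?g = "\<lambda>(\<beta>, \<gamma>). 4 * \<beta> + 6 * \<gamma>"
  have "counting_fps vdeg * (1 - fps_X ^ 3) = counting_fps ?g"
    unfolding vdeg_eq by (intro counting_fps_Pair finite_fibre_Pair finite_fibre_mult) simp_all
  moreover have "counting_fps ?g * (1 - fps_X ^ 4) = counting_fps ((*) 6)"
    by (intro counting_fps_Pair finite_fibre_mult) simp_all
  ultimately have *: "counting_fps vdeg * ((1 - fps_X ^ 3) * (1 - fps_X ^ 4) * (1 - fps_X ^ 6)) = 1"
    by (simp only: mult.assoc[symmetric]) (rule counting_fps_mult, simp)
  \<comment> \<open>A factor of 1 is nonzero, which permits the division.\<close>
  then have "(1 - fps_X ^ 3) * (1 - fps_X ^ 4) * (1 - fps_X ^ 6) \<noteq> (0 :: rat fps)"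
    using * by auto
  with * show ?thesis
    by (metis nonzero_mult_div_cancel_right)
qed

section \<open>A basis of each graded component\<close>

context
  fixes n :: nat
begin

abbreviation "filt_below \<equiv> agen_filt (int n - 1)"
abbreviation "symb x \<equiv> filt_below +>\<^bsub>agen_filt_module (int n)\<^esub> x"

lemma submodule_filt_below: "submodule filt_below cpoly_ring (agen_filt_module (int n))"
  by (rule submodule_agen_filt) simp

lemma carrier_agen_filt_module: "carrier (agen_filt_module (int n)) = agen_filt (int n)"
  by (simp add: agen_filt_module_def)

lemma symb_eq: "symb x = (\<lambda>h. h + x) ` filt_below"
  by (auto simp: a_r_coset_def' agen_filt_module_def)

text \<open>The difference has no coordinates above degree \<open>n\<close>, so it lies one level
  lower exactly when those in degree \<open>n\<close> cancel.\<close>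

lemma symb_eq_iff:
  assumes "x \<in> agen_filt (int n)" "y \<in> agen_filt (int n)"
  shows "symb x = symb y \<longleftrightarrow>
    (\<forall>k. vdeg k = n \<longrightarrow> Poly_Mapping.lookup (pbw_coord x) k = Poly_Mapping.lookup (pbw_coord y) k)"
proof -
  have "symb x = symb y \<longleftrightarrow> x - y \<in> filt_below"
  proof
    assume "symb x = symb y"
    moreover have "x \<in> symb x"
      unfolding symb_eq by (rule image_eqI[of _ _ 0]) (simp_all add: agen_filt_def agen.span_zero)
    ultimately show "x - y \<in> filt_below" by (auto simp: symb_eq)
  next
    assume d: "x - y \<in> filt_below"
    have "h + (x - y) \<in> filt_below" "h - (x - y) \<in> filt_below" if "h \<in> filt_below" for h
      using that d by (simp_all add: agen_filt_def agen.span_add agen.span_diff)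
    then show "symb x = symb y"
      unfolding symb_eq by (auto simp: image_iff algebra_simps) (metis add.commute diff_add_cancel add_diff_eq)+
  qed
  also have "\<dots> \<longleftrightarrow> (\<forall>k. vdeg k = n \<longrightarrow>
      Poly_Mapping.lookup (pbw_coord x) k = Poly_Mapping.lookup (pbw_coord y) k)"
    (is "_ \<longleftrightarrow> ?R")
  proof
    assume "x - y \<in> filt_below"
    then show ?R
      by (fastforce simp: agen_filt_iff pbw_coord_linear lookup_minus)
  next
    assume R: ?R
    have "x - y \<in> agen_filt (int n)"
      using assms by (simp add: agen_filt_def agen.span_diff)
    then show "x - y \<in> filt_below"
      using R unfolding agen_filt_iff pbw_coord_linear lookup_minus by force
  qed
  finally show ?thesis .
qed

lemma symb_sum:
  assumes "finite K" "\<And>k. k \<in> K \<Longrightarrow> y k \<in> agen_filt (int n)"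
  shows "finsum (agen_gr n) (\<lambda>k. a k \<odot>\<^bsub>agen_gr n\<^esub> symb (y k)) K = symb (\<Sum>k\<in>K. scale (a k) (y k))"
proof -
  interpret Q: Module.module cpoly_ring "agen_gr n" by (rule module_agen_gr)
  interpret N: abelian_subgroup filt_below "agen_filt_module (int n)"
    by (rule abelian_subgroup_of_submodule[OF module_agen_filt_module submodule_filt_below])
  have smult: "a \<odot>\<^bsub>agen_gr n\<^esub> symb x = symb (scale a x)" if "x \<in> agen_filt (int n)" for a x
    using quot_module_smult_coset[OF module_agen_filt_module submodule_filt_below, of a x] that
    by (simp add: agen_gr_def cpoly_ring_sel agen_filt_module_def)
  have add: "symb x \<oplus>\<^bsub>agen_gr n\<^esub> symb x' = symb (x + x')"
    if "x \<in> agen_filt (int n)" "x' \<in> agen_filt (int n)" for x x'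
    using N.a_rcos_sum[of x x'] that by (simp add: agen_gr_def agen_filt_module_def)
  have carr: "symb x \<in> carrier (agen_gr n)" if "x \<in> agen_filt (int n)" for x
    using that by (auto simp: agen_gr_def A_RCOSETS_def' carrier_agen_filt_module)
  have sc: "scale a x \<in> agen_filt (int n)" if "x \<in> agen_filt (int n)" for a x
    using that by (simp add: agen_filt_def agen.span_scale)
  show ?thesis using assms
  proof (induction K rule: finite_induct)
    case empty
    have "\<zero>\<^bsub>agen_gr n\<^esub> = symb 0" by (simp add: agen_gr_def symb_eq)
    then show ?case by simp
  next
    case (insert k K)
    have "(\<Sum>k\<in>K. scale (a k) (y k)) \<in> agen_filt (int n)"
      using insert(4) sc unfolding agen_filt_def by (auto intro: agen.span_sum)
    then show ?case
      using insert by (simp add: Q.M.finsum_insert Pi_iff smult carr sc add)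
  qed
qed

lemma module_basis_agen_gr:
  "module_basis cpoly_ring (agen_gr n) ((\<lambda>k. symb (pbw_monomial k)) ` {k. vdeg k = n})"
    (is "module_basis _ _ (?b ` ?K)")
  and inj_on_symb_pbw_monomial: "inj_on (\<lambda>k. symb (pbw_monomial k)) {k. vdeg k = n}"
proof -
  interpret Q: Module.module cpoly_ring "agen_gr n" by (rule module_agen_gr)
  have filt: "pbw_monomial k \<in> agen_filt (int n)" if "vdeg k = n" for k
    unfolding agen_filt_iff pbw_coord_pbw_monomial lookup_vmon using that by (metis order_refl)
  show inj: "inj_on ?b ?K"
  proof (rule inj_onI)
    fix k l assume kl: "k \<in> ?K" "l \<in> ?K" "?b k = ?b l"
    then have "Poly_Mapping.lookup (vmon k) k = Poly_Mapping.lookup (vmon l) k"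
      using symb_eq_iff[OF filt[of k] filt[of l]]
      by (simp add: pbw_coord_pbw_monomial del: split_paired_All)
    then show "k = l" by (auto simp: lookup_vmon split: if_splits)
  qed
  have carr: "?b ` ?K \<subseteq> carrier (agen_gr n)"
    using filt by (auto simp: agen_gr_def A_RCOSETS_def' carrier_agen_filt_module)
  \<comment> \<open>The coefficients of a class are forced to be the top-degree coordinates of a
    representative, so existence and uniqueness become statements about functions.\<close>
  have coords: "Q.is_coords (?b ` ?K) (symb y) c \<longleftrightarrow>
      (\<forall>X. X \<notin> ?b ` ?K \<longrightarrow> c X = 0) \<and> (\<forall>k\<in>?K. c (?b k) = Poly_Mapping.lookup (pbw_coord y) k)"
    if y: "y \<in> agen_filt (int n)" for y c
  proof -
    let ?s = "\<Sum>k\<in>?K. scale (c (?b k)) (pbw_monomial k)"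
    have s: "?s \<in> agen_filt (int n)"
      using filt unfolding agen_filt_def by (intro agen.span_sum agen.span_scale) auto
    have "finsum (agen_gr n) (\<lambda>X. c X \<odot>\<^bsub>agen_gr n\<^esub> X) (?b ` ?K)
        = finsum (agen_gr n) (\<lambda>k. c (?b k) \<odot>\<^bsub>agen_gr n\<^esub> ?b k) ?K"
      by (rule Q.M.finsum_reindex[OF _ inj])
        (rule Pi_I, rule Q.smult_closed, simp add: cpoly_ring_sel, use carr in blast)
    also have "\<dots> = symb ?s"
      using filt by (intro symb_sum finite_vdeg) simp
    finally have sum: "symb y = finsum (agen_gr n) (\<lambda>X. c X \<odot>\<^bsub>agen_gr n\<^esub> X) (?b ` ?K) \<longleftrightarrow>
        (\<forall>k\<in>?K. Poly_Mapping.lookup (pbw_coord ?s) k = Poly_Mapping.lookup (pbw_coord y) k)"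
      unfolding Ball_def mem_Collect_eq symb_eq_iff[OF s y, symmetric] by (metis (no_types))
    have "Poly_Mapping.lookup (pbw_coord ?s) l = c (?b l)" if "l \<in> ?K" for l
      using that finite_vdeg
      by (simp add: pbw_coord_sum lookup_sum pbw_coord_linear lookup_coef_mult pbw_coord_pbw_monomial
          lookup_vmon if_distrib cong: if_cong)
    then show ?thesis
      by (simp only: Q.is_coords_def cpoly_ring_sel sum UNIV_I simp_thms cong: ball_cong)
  qed
  show "module_basis cpoly_ring (agen_gr n) (?b ` ?K)"
    unfolding Q.module_basis_iff[OF finite_imageI[OF finite_vdeg]]
  proof (intro conjI ballI carr)
    fix X assume "X \<in> carrier (agen_gr n)"
    then obtain y where y: "y \<in> agen_filt (int n)" "X = symb y"
      by (auto simp: agen_gr_def A_RCOSETS_def' carrier_agen_filt_module)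
    show "\<exists>!c. Q.is_coords (?b ` ?K) X c"
      unfolding y(2) coords[OF y(1)]
    proof (rule ex_ex1I)
      \<comment> \<open>Injectivity of the map from monomials to classes lets the witness recover
        the exponent triple from its class.\<close>
      show "\<exists>c. (\<forall>X. X \<notin> ?b ` ?K \<longrightarrow> c X = 0) \<and> (\<forall>k\<in>?K. c (?b k) = Poly_Mapping.lookup (pbw_coord y) k)"
        by (rule exI[of _ "\<lambda>X. if X \<in> ?b ` ?K then Poly_Mapping.lookup (pbw_coord y) (the_inv_into ?K ?b X) else 0"])
          (simp add: the_inv_into_f_f[OF inj] del: split_paired_All)
    next
      fix c c'
      assume c: "(\<forall>X. X \<notin> ?b ` ?K \<longrightarrow> c X = 0) \<and> (\<forall>k\<in>?K. c (?b k) = Poly_Mapping.lookup (pbw_coord y) k)"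
        and c': "(\<forall>X. X \<notin> ?b ` ?K \<longrightarrow> c' X = 0) \<and> (\<forall>k\<in>?K. c' (?b k) = Poly_Mapping.lookup (pbw_coord y) k)"
      show "c = c'"
      proof
        fix X
        show "c X = c' X"
        proof (cases "X \<in> ?b ` ?K")
          case True
          then obtain k where k: "X = ?b k" "k \<in> ?K" by (rule imageE)
          show ?thesis
            unfolding k(1) c[THEN conjunct2, rule_format, OF k(2)] c'[THEN conjunct2, rule_format, OF k(2)] ..
        next
          case False
          then show ?thesis using c c' by metis
        qed
      qed
    qed
  qed
qed

end

theorem proposition2p1:
  shows "(inj pbw_monomial \<and> agen.independent (range pbw_monomial) \<and>
          agen.span (range pbw_monomial) = UNIV) \<and>
         (\<forall>n. \<exists>r. free_of_rank cpoly_ring (agen_gr n) r) \<and>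
         agen_hilbert_series = 1 / ((1 - fps_X ^ 3) * (1 - fps_X ^ 4) * (1 - fps_X ^ 6))"
proof (intro conjI allI)
  show "\<exists>r. free_of_rank cpoly_ring (agen_gr n) r" for n
    unfolding free_of_rank_def using module_basis_agen_gr finite_vdeg by blast
  \<comment> \<open>Distinct monomials of degree \<open>n\<close> have distinct classes, so counting
    the basis counts exponent triples.\<close>
  have "module_rank cpoly_ring (agen_gr n) = card {k. vdeg k = n}" for n
    using module_rank_eq[OF module_agen_gr module_basis_agen_gr finite_imageI[OF finite_vdeg]]
    by (simp add: card_image inj_on_symb_pbw_monomial)
  then have "agen_hilbert_series = counting_fps vdeg"
    by (simp add: agen_hilbert_series_def counting_fps_def)
  then show "agen_hilbert_series = 1 / ((1 - fps_X ^ 3) * (1 - fps_X ^ 4) * (1 - fps_X ^ 6))"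
    by (simp only: counting_fps_vdeg)
qed (fact inj_pbw_monomial independent_pbw_monomial span_pbw_monomial)+

end
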